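(* Let $F$ be a proper rational holomorphic map of degree two from the unit ball $\mathbb{B}^2\subset\mathbb{C}^2$ into the unit ball $\mathbb{B}^N\subset\mathbb{C}^N$. Then $F$ is equivalent to a proper polynomial holomorphic map from $\mathbb{B}^2$ into $\mathbb{B}^N$.
   Context: Two proper rational holomorphic maps $F,G:\mathbb{B}^n\to\mathbb{B}^N$ are called equivalent if there are $\sigma\in \mathrm{Aut}(\mathbb{B}^n)$ and $\tau\in \mathrm{Aut}(\mathbb{B}^N)$ (holomorphic automorphisms) with $F=\tau\circ G\circ\sigma$. A polynomial map is a map all of whose components are holomorphic polynomials. For a rational map $F=(P_1,\dots,P_N)/q$, where $P_1,\dots,P_N,q$ are holomorphic polynomials with no nonconstant common factor, the degree is $\deg(F)=\max\{\deg P_1,\dots,\deg P_N,\deg q\}$. *)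

theory Defs
  imports "HOL-Analysis.Analysis" "HOL-Library.Poly_Mapping"
begin

text \<open>
  A polynomial in the variables indexed by \<open>'n\<close> is a finitely supported map from exponent vectors
  to coefficients; with the convolution product of \<^theory>\<open>HOL-Library.Poly_Mapping\<close> these form a
  commutative ring, so \<open>dvd\<close> is divisibility of polynomials.
\<close>

type_synonym 'n cpoly = "('n \<Rightarrow>\<^sub>0 nat) \<Rightarrow>\<^sub>0 complex"

definition eval_cpoly :: "('n::finite) cpoly \<Rightarrow> complex ^ 'n \<Rightarrow> complex" where
  "eval_cpoly p z =
     (\<Sum>m\<in>Poly_Mapping.keys p. Poly_Mapping.lookup p m * (\<Prod>i\<in>UNIV. (z $ i) ^ Poly_Mapping.lookup m i))"

text \<open>The total degree; by convention it is 0 for the zero polynomial.\<close>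

definition total_degree :: "('n::finite) cpoly \<Rightarrow> nat" where
  "total_degree p = Max (insert 0 ((\<lambda>m. \<Sum>i\<in>UNIV. Poly_Mapping.lookup m i) ` Poly_Mapping.keys p))"

text \<open>
  \<open>has_derivative\<close> is differentiability over the reals; holomorphy on an open set asks in addition
  that the derivative be linear over the complex numbers.
\<close>

definition holomorphic_map :: "(complex ^ 'n::finite \<Rightarrow> complex ^ 'm::finite) \<Rightarrow> (complex ^ 'n) set \<Rightarrow> bool" where
  "holomorphic_map f S \<longleftrightarrow>
     (\<forall>z\<in>S. \<exists>f'. (f has_derivative f') (at z) \<and> Vector_Spaces.linear (*s) (*s) f')"

definition proper_holomorphic_ball_map :: "(complex ^ 'n::finite \<Rightarrow> complex ^ 'm::finite) \<Rightarrow> bool" where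
  "proper_holomorphic_ball_map F \<longleftrightarrow>
     holomorphic_map F (ball 0 1) \<and>
     proper_map (top_of_set (ball 0 1)) (top_of_set (ball 0 1)) F"

text \<open>
  The library's \<^const>\<open>proper_map\<close> (closed, with compact fibres) is here the usual condition
  that preimages of compact sets be compact.
\<close>

lemma proper_map_ball_iff:
  fixes F :: "complex ^ 'n::finite \<Rightarrow> complex ^ 'm::finite"
  shows "proper_map (top_of_set (ball 0 1)) (top_of_set (ball 0 1)) F \<longleftrightarrow>
         F ` ball 0 1 \<subseteq> ball 0 1 \<and>
         (\<forall>K. compact K \<and> K \<subseteq> ball 0 1 \<longrightarrow> compact {z \<in> ball 0 1. F z \<in> K})"
proof -
  have m: "metrizable_space (top_of_set (ball 0 1 :: (complex ^ 'm) set))"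
    and n: "metrizable_space (top_of_set (ball 0 1 :: (complex ^ 'n) set))"
    by (simp_all add: metrizable_space_euclidean metrizable_space_subtopology)
  have "proper_map (top_of_set (ball 0 1)) (top_of_set (ball 0 1)) F \<longleftrightarrow>
         F \<in> ball 0 1 \<rightarrow> ball 0 1 \<and>
         (\<forall>K. compactin (top_of_set (ball 0 1)) K
            \<longrightarrow> compactin (top_of_set (ball 0 1)) {z \<in> ball 0 1. F z \<in> K})"
    using proper_eq_compact_map[of "top_of_set (ball 0 1 :: (complex ^ 'm) set)"
        "top_of_set (ball 0 1 :: (complex ^ 'n) set)" F]
      metrizable_imp_k_space[OF m]
      Hausdorff_imp_kc_space[OF metrizable_imp_Hausdorff_space[OF m]]
      Hausdorff_imp_kc_space[OF metrizable_imp_Hausdorff_space[OF n]]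
    by simp
  then show ?thesis
    by (auto simp: compactin_subtopology image_subset_iff_funcset)
qed

definition ball_automorphism :: "(complex ^ 'n::finite \<Rightarrow> complex ^ 'n) \<Rightarrow> bool" where
  "ball_automorphism \<sigma> \<longleftrightarrow>
     bij_betw \<sigma> (ball 0 1) (ball 0 1) \<and>
     holomorphic_map \<sigma> (ball 0 1) \<and>
     holomorphic_map (inv_into (ball 0 1) \<sigma>) (ball 0 1)"

definition ball_maps_equivalent ::
  "(complex ^ 'n::finite \<Rightarrow> complex ^ 'm::finite) \<Rightarrow> (complex ^ 'n \<Rightarrow> complex ^ 'm) \<Rightarrow> bool" where
  "ball_maps_equivalent F G \<longleftrightarrow>
     (\<exists>\<sigma> \<tau>. ball_automorphism \<sigma> \<and> ball_automorphism \<tau> \<and>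
        (\<forall>z\<in>ball 0 1. F z = \<tau> (G (\<sigma> z))))"

definition polynomial_ball_map :: "(complex ^ 'n::finite \<Rightarrow> complex ^ 'm::finite) \<Rightarrow> bool" where
  "polynomial_ball_map G \<longleftrightarrow>
     (\<exists>P :: 'm \<Rightarrow> 'n cpoly. \<forall>z\<in>ball 0 1. \<forall>j. G z $ j = eval_cpoly (P j) z)"

text \<open>
  \<open>F = (P\<^sub>j)\<^sub>j / q\<close> in lowest terms. The denominator is not assumed to be zero-free on the ball:
  the quotient represents \<open>F\<close> wherever \<open>q\<close> does not vanish.
\<close>

definition reduced_fraction ::
  "(complex ^ 'n::finite \<Rightarrow> complex ^ 'm::finite) \<Rightarrow> ('m \<Rightarrow> 'n cpoly) \<Rightarrow> 'n cpoly \<Rightarrow> bool" where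
  "reduced_fraction F P q \<longleftrightarrow>
     q \<noteq> 0 \<and>
     (\<forall>d. d dvd q \<and> (\<forall>j. d dvd P j) \<longrightarrow> total_degree d = 0) \<and>
     (\<forall>z\<in>ball 0 1. eval_cpoly q z \<noteq> 0 \<longrightarrow> (\<forall>j. F z $ j = eval_cpoly (P j) z / eval_cpoly q z))"

definition rational_ball_map_of_degree ::
  "(complex ^ 'n::finite \<Rightarrow> complex ^ 'm::finite) \<Rightarrow> nat \<Rightarrow> bool" where
  "rational_ball_map_of_degree F k \<longleftrightarrow>
     (\<exists>P q. reduced_fraction F P q \<and>
        k = Max (insert (total_degree q) (range (\<lambda>j. total_degree (P j)))))"

end

theory Submission
  imports Defs "HOL-Complex_Analysis.Conformal_Mappings"
begin

text \<open>
  Write \<open>F = p / q\<close> in lowest terms and let \<open>\<langle>z, w\<rangle>\<close> be the Hermitian product. Since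
  \<open>|q|\<^sup>2 - |p|\<^sup>2\<close> vanishes on the sphere, the degree bound gives a polarised factorisation
  \<open>q(z) q(w)\<^sup>* - \<langle>p(z), p(w)\<rangle> = (1 - \<langle>z, w\<rangle>) A(z, w)\<close> with \<open>A\<close> Hermitian and affine in \<open>z\<close>.
  If \<open>A(z\<^sub>0, z\<^sub>0) = 0\<close> at a point of the closed ball, then the Schwarz lemma forces
  \<open>q(z\<^sub>0) = 0\<close>, and the signature of \<open>|q|\<^sup>2 - |p|\<^sup>2\<close> forces \<open>p\<close> and \<open>q\<close> to vanish on a whole line
  through \<open>z\<^sub>0\<close>, contradicting reducedness. Hence \<open>A(z, z) > 0\<close> on the closed ball, and
  \<open>(1 - |z|\<^sup>2) / A(z, z)\<close> has an interior maximum \<open>w\<close>. Criticality there reads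
  \<open>1 - \<langle>z, w\<rangle> = \<kappa> A(z, w)\<close> for all \<open>z\<close>, so \<open>q(z) - \<langle>p(z), F(w)\<rangle>\<close> is a constant multiple of
  \<open>(1 - \<langle>z, w\<rangle>)\<^sup>2\<close>. Conjugating \<open>F\<close> by the ball involutions that exchange \<open>0\<close> with \<open>F(w)\<close>
  and with \<open>w\<close> therefore yields a map with constant denominator.
\<close>

section \<open>The Hermitian product and holomorphy\<close>

text \<open>The \<open>inner\<close> of this type is only the real part of this product; the
  polarised identities below need its full complex value.\<close>

definition cin :: "complex ^ 'n::finite \<Rightarrow> complex ^ 'n \<Rightarrow> complex" where
  "cin z w = (\<Sum>i\<in>UNIV. z $ i * cnj (w $ i))"

lemma cin_add_left: "cin (x + y) w = cin x w + cin y w"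
  by (simp add: cin_def distrib_right sum.distrib)

lemma cin_add_right: "cin w (x + y) = cin w x + cin w y"
  by (simp add: cin_def distrib_left sum.distrib)

lemma cin_diff_left: "cin (x - y) w = cin x w - cin y w"
  by (simp add: cin_def left_diff_distrib sum_subtractf)

lemma cin_diff_right: "cin w (x - y) = cin w x - cin w y"
  by (simp add: cin_def right_diff_distrib sum_subtractf)

lemma cin_scale_left: "cin (c *s x) w = c * cin x w"
  by (simp add: cin_def sum_distrib_left mult.assoc)

lemma cin_scale_right: "cin w (c *s x) = cnj c * cin w x"
  by (simp add: cin_def sum_distrib_left mult_ac)

lemma cin_0 [simp]: "cin 0 w = 0" "cin w 0 = 0"
  by (simp_all add: cin_def)

lemmas cin_simps = cin_add_left cin_add_right cin_diff_left cin_diff_right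
  cin_scale_left cin_scale_right

lemma cnj_cin: "cnj (cin z w) = cin w z"
  by (simp add: cin_def mult.commute)

lemma cin_self: "cin z z = of_real ((norm z)\<^sup>2)"
proof -
  have "(norm z)\<^sup>2 = (\<Sum>i\<in>UNIV. (norm (z $ i))\<^sup>2)"
    by (simp add: norm_vec_def L2_set_def sum_nonneg)
  then show ?thesis
    by (simp only: cin_def of_real_sum complex_norm_square)
qed

lemma norm_cin_le: "norm (cin z w) \<le> norm z * norm w"
proof -
  have "norm (cin z w) \<le> (\<Sum>i\<in>UNIV. \<bar>norm (z $ i)\<bar> * \<bar>norm (w $ i)\<bar>)"
    unfolding cin_def by (rule order_trans[OF norm_sum]) (simp add: norm_mult)
  also have "\<dots> \<le> norm z * norm w"
    unfolding norm_vec_def by (rule L2_set_mult_ineq)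
  finally show ?thesis .
qed

lemma norm_cin_less_1: "norm z < 1 \<Longrightarrow> norm w \<le> 1 \<Longrightarrow> norm (cin z w) < 1"
  using norm_cin_le[of z w] mult_left_le[of "norm w" "norm z"] by simp

lemma one_minus_cin_neq_0: "norm z < 1 \<Longrightarrow> norm w \<le> 1 \<Longrightarrow> 1 - cin z w \<noteq> 0"
  using norm_cin_less_1[of z w] by auto

lemma norm_vector_scale: "norm (c *s (x :: complex ^ 'n::finite)) = norm c * norm x"
proof -
  have "of_real ((norm (c *s x))\<^sup>2) = (of_real ((norm c * norm x)\<^sup>2) :: complex)"
    unfolding cin_self[symmetric] power_mult_distrib of_real_mult cin_scale_left cin_scale_right complex_norm_square
    by simp
  then have "(norm (c *s x))\<^sup>2 = (norm c * norm x)\<^sup>2"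
    using of_real_eq_iff by blast
  then show ?thesis
    by (simp add: power2_eq_iff_nonneg)
qed

lemma continuous_on_cin [continuous_intros]:
  "continuous_on S f \<Longrightarrow> continuous_on S g \<Longrightarrow> continuous_on S (\<lambda>x. cin (f x) (g x))"
  unfolding cin_def by (intro continuous_intros)

text \<open>Real linearity of the derivative is already part of \<open>has_derivative\<close>, so
  complex homogeneity is the only extra demand. Working with scalar functions gives simple closure
  rules for sums, products and inverses.\<close>

definition holo_at :: "(complex ^ 'n::finite \<Rightarrow> complex) \<Rightarrow> complex ^ 'n \<Rightarrow> bool" where
  "holo_at f z \<longleftrightarrow> (\<exists>f'. (f has_derivative f') (at z) \<and> (\<forall>c x. f' (c *s x) = c * f' x))"

lemma complex_linear_iff:
  fixes f :: "complex ^ 'n::finite \<Rightarrow> complex ^ 'm::finite"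
  shows "Vector_Spaces.linear (*s) (*s) f \<longleftrightarrow>
    (\<forall>x y. f (x + y) = f x + f y) \<and> (\<forall>c x. f (c *s x) = c *s f x)"
  by (simp add: Vector_Spaces.linear_iff vec.vector_space_axioms)

lemma holomorphic_map_iff:
  "holomorphic_map f S \<longleftrightarrow> (\<forall>z\<in>S. \<forall>i. holo_at (\<lambda>x. f x $ i) z)"
proof
  assume L: "holomorphic_map f S"
  show "\<forall>z\<in>S. \<forall>i. holo_at (\<lambda>x. f x $ i) z"
  proof (intro ballI allI)
    fix z i assume "z \<in> S"
    with L obtain f' where f': "(f has_derivative f') (at z)" "Vector_Spaces.linear (*s) (*s) f'"
      unfolding holomorphic_map_def by blast
    have "((\<lambda>x. f x $ i) has_derivative (\<lambda>x. f' x $ i)) (at z)"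
      by (rule bounded_linear.has_derivative[OF bounded_linear_vec_nth f'(1)])
    then show "holo_at (\<lambda>x. f x $ i) z"
      unfolding holo_at_def using f'(2)
      by (intro exI[of _ "\<lambda>x. f' x $ i"]) (simp add: complex_linear_iff)
  qed
next
  assume R: "\<forall>z\<in>S. \<forall>i. holo_at (\<lambda>x. f x $ i) z"
  show "holomorphic_map f S"
    unfolding holomorphic_map_def
  proof
    fix z assume "z \<in> S"
    with R have "\<forall>i. \<exists>f'. ((\<lambda>x. f x $ i) has_derivative f') (at z) \<and> (\<forall>c x. f' (c *s x) = c * f' x)"
      unfolding holo_at_def by blast
    then obtain f' where f': "\<And>i. ((\<lambda>x. f x $ i) has_derivative f' i) (at z)"
        "\<And>i c x. f' i (c *s x) = c * f' i x"
      by metis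
    have d: "(f has_derivative (\<lambda>x. \<chi> i. f' i x)) (at z)"
    proof (subst has_derivative_componentwise_within, rule ballI)
      fix b :: "complex ^ 'b" assume "b \<in> Basis"
      then obtain i u where b: "b = axis i u"
        by (auto simp: Basis_vec_def)
      have "((\<lambda>x. f x $ i \<bullet> u) has_derivative (\<lambda>x. f' i x \<bullet> u)) (at z)"
        by (intro bounded_linear.has_derivative[OF bounded_linear_inner_left f'(1)])
      then show "((\<lambda>x. f x \<bullet> b) has_derivative (\<lambda>x. (\<chi> i. f' i x) \<bullet> b)) (at z)"
        by (simp add: b inner_axis)
    qed
    moreover have "Vector_Spaces.linear (*s) (*s) (\<lambda>x. \<chi> i. f' i x)"
      unfolding complex_linear_iff
      using f'(2) linear_add[OF has_derivative_linear[OF f'(1)]] by (simp add: vec_eq_iff)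
    ultimately show "\<exists>f'. (f has_derivative f') (at z) \<and> Vector_Spaces.linear (*s) (*s) f'"
      by blast
  qed
qed

lemma holo_at_const [simp]: "holo_at (\<lambda>x. c) z"
  unfolding holo_at_def by (rule exI[of _ "\<lambda>x. 0"]) auto

lemma holo_at_nth [simp]: "holo_at (\<lambda>x. x $ i) z"
  unfolding holo_at_def
  by (rule exI[of _ "\<lambda>x. x $ i"])
    (auto intro!: bounded_linear_imp_has_derivative bounded_linear_vec_nth)

lemma holo_at_add: "holo_at f z \<Longrightarrow> holo_at g z \<Longrightarrow> holo_at (\<lambda>x. f x + g x) z"
  unfolding holo_at_def
  by (elim exE conjE, rule exI, rule conjI, erule (1) has_derivative_add) (simp add: distrib_left)

lemma holo_at_mult: "holo_at f z \<Longrightarrow> holo_at g z \<Longrightarrow> holo_at (\<lambda>x. f x * g x) z"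
  unfolding holo_at_def
  by (elim exE conjE, rule exI, rule conjI, erule (1) has_derivative_mult) (simp add: algebra_simps)

lemma holo_at_diff: "holo_at f z \<Longrightarrow> holo_at g z \<Longrightarrow> holo_at (\<lambda>x. f x - g x) z"
  using holo_at_add[of f z "\<lambda>x. (-1) * g x"] holo_at_mult[of "\<lambda>x. -1" z g] by simp

lemma holo_at_inverse: "holo_at f z \<Longrightarrow> f z \<noteq> 0 \<Longrightarrow> holo_at (\<lambda>x. inverse (f x)) z"
  unfolding holo_at_def
  by (elim exE conjE, rule exI, rule conjI, erule (1) Deriv.has_derivative_inverse) (simp add: algebra_simps)

lemma holo_at_sum: "(\<And>i. i \<in> I \<Longrightarrow> holo_at (f i) z) \<Longrightarrow> holo_at (\<lambda>x. \<Sum>i\<in>I. f i x) z"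
  by (induction I rule: infinite_finite_induct) (auto intro: holo_at_add)

lemma holomorphic_map_compose:
  assumes "holomorphic_map f S" "holomorphic_map g T" "f ` S \<subseteq> T"
  shows "holomorphic_map (g \<circ> f) S"
  unfolding holomorphic_map_def
proof
  fix z assume z: "z \<in> S"
  obtain f' where f': "(f has_derivative f') (at z)" "Vector_Spaces.linear (*s) (*s) f'"
    using assms(1) z unfolding holomorphic_map_def by blast
  obtain g' where g': "(g has_derivative g') (at (f z))" "Vector_Spaces.linear (*s) (*s) g'"
    using assms(2,3) z unfolding holomorphic_map_def by blast
  have "(g \<circ> f has_derivative g' \<circ> f') (at z)"
    by (rule diff_chain_at[OF f'(1) g'(1)])
  moreover have "Vector_Spaces.linear (*s) (*s) (g' \<circ> f')"
    using f'(2) g'(2) by (simp add: complex_linear_iff)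
  ultimately show "\<exists>f'. (g \<circ> f has_derivative f') (at z) \<and> Vector_Spaces.linear (*s) (*s) f'"
    by blast
qed

lemma holomorphic_map_imp_continuous_on: "holomorphic_map f S \<Longrightarrow> continuous_on S f"
  unfolding holomorphic_map_def
  by (meson continuous_at_imp_continuous_on has_derivative_continuous)

lemma holomorphic_map_cong:
  assumes "holomorphic_map f S" "open S" "\<And>z. z \<in> S \<Longrightarrow> f z = g z"
  shows "holomorphic_map g S"
  using assms unfolding holomorphic_map_def
  by (meson has_derivative_transform_within_open)

section \<open>Involutions of the ball and the Schwarz lemma\<close>

text \<open>
  With \<open>P\<close> the orthogonal projection to the line of \<open>a\<close>, the usual numerator is
  \<open>a - P z - s (z - P z)\<close>. Using \<open>(1 - s) / |a|\<^sup>2 = 1 / (1 + s)\<close> removes the division by \<open>|a|\<^sup>2\<close>, so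
  that \<open>a = 0\<close> needs no special case.
\<close>

definition ball_involution :: "complex ^ 'n::finite \<Rightarrow> complex ^ 'n \<Rightarrow> complex ^ 'n" where
  "ball_involution a z = (let s = complex_of_real (sqrt (1 - (norm a)\<^sup>2)) in
     inverse (1 - cin z a) *s (a - s *s z - (cin z a / (1 + s)) *s a))"

lemma ball_involution_facts:
  fixes a :: "complex ^ 'n::finite"
  assumes a: "norm a < 1"
  defines "s \<equiv> complex_of_real (sqrt (1 - (norm a)\<^sup>2))"
  shows "1 + s \<noteq> 0" "s \<noteq> 0" "cin a a = 1 - s\<^sup>2" "cnj s = s" "s\<^sup>2 = of_real (1 - (norm a)\<^sup>2)"
proof -
  have p: "1 - (norm a)\<^sup>2 > 0"
    using a by (simp add: power_less_one_iff)
  then have "sqrt (1 - (norm a)\<^sup>2) > 0"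
    by simp
  then show "s \<noteq> 0"
    by (simp add: s_def)
  have "Re (1 + s) > 0"
    using \<open>sqrt (1 - (norm a)\<^sup>2) > 0\<close> by (simp add: s_def del: real_sqrt_gt_0_iff)
  then show "1 + s \<noteq> 0"
    by force
  show sq: "s\<^sup>2 = of_real (1 - (norm a)\<^sup>2)"
    unfolding s_def of_real_power[symmetric] using p by simp
  then show "cin a a = 1 - s\<^sup>2"
    by (simp add: cin_self)
  show "cnj s = s"
    by (simp add: s_def)
qed

text \<open>The polarised form of the basic identity for the involutions. Once denominators are
  cleared it is an identity for the numerators \<open>n z\<close> and \<open>n w\<close>, which
  follows from \<open>cin a a = 1 - s^2\<close> and \<open>d * (1 + s) = 1\<close>. The diagonal
  case shows that the ball is preserved.\<close>

lemma one_minus_cin_ball_involution: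
  fixes a z w :: "complex ^ 'n::finite"
  assumes a: "norm a < 1" and z: "1 - cin z a \<noteq> 0" and w: "1 - cin a w \<noteq> 0"
  shows "1 - cin (ball_involution a z) (ball_involution a w) =
    of_real (1 - (norm a)\<^sup>2) * (1 - cin z w) / ((1 - cin z a) * (1 - cin a w))"
proof -
  define s where "s = complex_of_real (sqrt (1 - (norm a)\<^sup>2))"
  note s = ball_involution_facts[OF a, folded s_def]
  define d where "d = 1 / (1 + s)"
  have d: "d * (1 + s) = 1"
    using s(1) by (simp add: d_def)
  have cd: "cnj d = d"
    by (simp add: d_def s)
  have wa: "cnj (cin w a) = cin a w"
    by (simp add: cnj_cin)
  define n where "n z = a - s *s z - (cin z a * d) *s a" for z
  have phi: "ball_involution a z = inverse (1 - cin z a) *s n z" for z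
    by (simp add: ball_involution_def s_def[symmetric] Let_def n_def d_def)
  have "cin (n z) (n w) = (1 - cin z a) * (1 - cin a w) - s\<^sup>2 * (1 - cin z w)"
  proof -
    define x y u where "x = cin z a" and "y = cin a w" and "u = cin z w"
    have "cin (n z) (n w) = (1 - s\<^sup>2) - s * y - y * d * (1 - s\<^sup>2)
        - s * (x - s * u - y * d * x)
        - x * d * ((1 - s\<^sup>2) - s * y - y * d * (1 - s\<^sup>2))"
      unfolding n_def x_def y_def u_def
      by (simp add: cin_simps s(3,4) cd wa cnj_cin algebra_simps)
    also have "\<dots> = (1 - x) * (1 - y) - s\<^sup>2 * (1 - u)"
      using d by algebra
    finally show ?thesis
      by (simp add: x_def y_def u_def)
  qed
  moreover have "cnj (1 - cin w a) = 1 - cin a w"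
    by (simp add: wa)
  ultimately have "1 - cin (ball_involution a z) (ball_involution a w) =
      1 - ((1 - cin z a) * (1 - cin a w) - s\<^sup>2 * (1 - cin z w)) / ((1 - cin z a) * (1 - cin a w))"
    unfolding phi cin_scale_left cin_scale_right complex_cnj_inverse by (simp add: divide_inverse)
  also have "\<dots> = s\<^sup>2 * (1 - cin z w) / ((1 - cin z a) * (1 - cin a w))"
    using z w by (simp add: diff_divide_distrib)
  finally show ?thesis
    by (simp only: s(5))
qed

lemma ball_involution_involutive:
  fixes a z :: "complex ^ 'n::finite"
  assumes a: "norm a < 1" and z: "1 - cin z a \<noteq> 0"
  shows "1 - cin (ball_involution a z) a = of_real (1 - (norm a)\<^sup>2) / (1 - cin z a)"
    and "ball_involution a (ball_involution a z) = z"
proof -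
  define s where "s = complex_of_real (sqrt (1 - (norm a)\<^sup>2))"
  note s = ball_involution_facts[OF a, folded s_def]
  define d where "d = 1 / (1 + s)"
  have d: "d * (1 + s) = 1"
    using s(1) by (simp add: d_def)
  define n where "n z = a - s *s z - (cin z a * d) *s a" for z
  have phi: "ball_involution a z = inverse (1 - cin z a) *s n z" for z
    by (simp add: ball_involution_def s_def[symmetric] Let_def n_def d_def)
  define x where "x = cin z a"
  have x: "1 - x \<noteq> 0"
    using z by (simp add: x_def)
  have n: "cin (n z) a = (1 - s\<^sup>2) - x"
  proof -
    have "cin (n z) a = (1 - s\<^sup>2) - s * x - x * d * (1 - s\<^sup>2)"
      by (simp add: n_def cin_simps s(3) x_def)
    also have "\<dots> = (1 - s\<^sup>2) - x"
      using d by algebra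
    finally show ?thesis .
  qed
  have "1 - cin (ball_involution a z) a = s\<^sup>2 / (1 - x)"
    unfolding phi cin_simps n x_def[symmetric] using x by (simp add: field_simps)
  then show c: "1 - cin (ball_involution a z) a = of_real (1 - (norm a)\<^sup>2) / (1 - cin z a)"
    by (simp add: s(5) x_def)
  then have c': "1 - cin (ball_involution a z) a = s\<^sup>2 / (1 - x)"
    by (simp add: s(5) x_def)
  have c'': "cin (ball_involution a z) a = (1 - s\<^sup>2 - x) / (1 - x)"
    unfolding phi cin_simps n x_def[symmetric] using x by (simp add: field_simps)
  show "ball_involution a (ball_involution a z) = z"
    unfolding vec_eq_iff
  proof
    fix i
    define A Z where "A = a $ i" and "Z = z $ i"
    \<comment> \<open>Up to the factor \<open>(1 - x) / s^2\<close>, the left side divided by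
      \<open>1 - x\<close> is the \<open>i\<close>-th coordinate of the second application.\<close>
    have "(1 - x) * A - s * (A - s * Z - x * d * A) - (1 - s\<^sup>2 - x) * d * A = s\<^sup>2 * Z"
      using d by algebra
    then have "(1 - x) / s\<^sup>2 * (((1 - x) * A - s * (A - s * Z - x * d * A) - (1 - s\<^sup>2 - x) * d * A) / (1 - x)) = Z"
      using s(2) x by simp
    moreover have "((1 - x) * A - s * (A - s * Z - x * d * A) - (1 - s\<^sup>2 - x) * d * A) / (1 - x)
        = A - s * (inverse (1 - x) * (A - s * Z - x * d * A)) - (1 - s\<^sup>2 - x) / (1 - x) * d * A"
      using x by (simp add: diff_divide_distrib) (simp add: divide_inverse algebra_simps)
    moreover have "ball_involution a (ball_involution a z) $ i =
        inverse (s\<^sup>2 / (1 - x)) * (A - s * (ball_involution a z $ i) - (1 - s\<^sup>2 - x) / (1 - x) * d * A)"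
      by (subst phi) (simp only: n_def c'[unfolded c''] c'' vector_smult_component vector_minus_component A_def)
    moreover have "ball_involution a z $ i = inverse (1 - x) * (A - s * Z - x * d * A)"
      by (subst phi) (simp only: n_def x_def vector_smult_component vector_minus_component A_def Z_def)
    ultimately show "ball_involution a (ball_involution a z) $ i = z $ i"
      by (simp only: Z_def inverse_divide)
  qed
qed

lemma ball_involution_involutive_ball [simp]:
  "norm a < 1 \<Longrightarrow> norm z < 1 \<Longrightarrow> ball_involution a (ball_involution a z) = z"
  by (simp only: ball_involution_involutive(2) one_minus_cin_neq_0 less_imp_le not_False_eq_True)

lemma norm_ball_involution:
  assumes "norm a < 1" "norm z < 1"
  shows "1 - (norm (ball_involution a z))\<^sup>2 =
    (1 - (norm a)\<^sup>2) * (1 - (norm z)\<^sup>2) / (norm (1 - cin z a))\<^sup>2"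
proof -
  have nz: "1 - cin z a \<noteq> 0" and nz': "1 - cin a z \<noteq> 0"
    using assms one_minus_cin_neq_0 less_imp_le by blast+
  have "1 - cin a z = cnj (1 - cin z a)"
    by (simp add: cnj_cin)
  then have "complex_of_real (1 - (norm (ball_involution a z))\<^sup>2) =
      of_real ((1 - (norm a)\<^sup>2) * (1 - (norm z)\<^sup>2) / (norm (1 - cin z a))\<^sup>2)"
    using one_minus_cin_ball_involution[OF assms(1) nz nz']
    unfolding of_real_divide of_real_mult complex_norm_square
    by (simp add: cin_self)
  then show ?thesis
    using of_real_eq_iff by blast
qed

lemma ball_involution_in_ball:
  assumes "norm a < 1" "norm z < 1"
  shows "norm (ball_involution a z) < 1"
proof -
  have "norm (1 - cin z a) > 0"
    using assms one_minus_cin_neq_0[of z a] by simp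
  moreover have "1 - (norm a)\<^sup>2 > 0" "1 - (norm z)\<^sup>2 > 0"
    using assms by (simp_all add: power_less_one_iff)
  ultimately have "1 - (norm (ball_involution a z))\<^sup>2 > 0"
    unfolding norm_ball_involution[OF assms] by simp
  then show ?thesis
    by (simp add: power_less_one_iff)
qed

lemma holomorphic_ball_involution:
  assumes "norm a < 1"
  shows "holomorphic_map (ball_involution a) (ball 0 1)"
  unfolding holomorphic_map_iff
proof (intro ballI allI)
  fix z i assume z: "z \<in> ball (0 :: complex ^ 'a) 1"
  have c: "holo_at (\<lambda>x. cin x a) z"
    unfolding cin_def by (intro holo_at_sum holo_at_mult holo_at_nth holo_at_const)
  have "1 - cin z a \<noteq> 0"
    using z assms by (intro one_minus_cin_neq_0) auto
  then show "holo_at (\<lambda>x. ball_involution a x $ i) z"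
    unfolding ball_involution_def Let_def divide_inverse[of "cin _ _"]
      vector_smult_component vector_minus_component
    by (intro holo_at_mult holo_at_inverse holo_at_diff c holo_at_const holo_at_nth)
qed

section \<open>Involutions as automorphisms and conjugation by them\<close>

lemma bij_betw_ball_involution:
  assumes "norm a < 1"
  shows "bij_betw (ball_involution a) (ball 0 1) (ball 0 1)"
  using assms
  by (intro bij_betw_byWitness[where f' = "ball_involution a"])
    (auto simp: ball_involution_in_ball)

lemma ball_automorphism_ball_involution:
  assumes "norm a < 1"
  shows "ball_automorphism (ball_involution a)"
proof -
  have "inv_into (ball 0 1) (ball_involution a) z = ball_involution a z" if "z \<in> ball 0 1" for z
    using assms that bij_betw_ball_involution[OF assms]
    by (intro inv_into_f_eq)
      (auto simp: bij_betw_def ball_involution_in_ball)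
  then show ?thesis
    unfolding ball_automorphism_def
    using bij_betw_ball_involution[OF assms] holomorphic_ball_involution[OF assms]
      holomorphic_map_cong[OF holomorphic_ball_involution[OF assms] open_ball]
    by metis
qed

lemma proper_map_ball_involution:
  assumes "norm a < 1"
  shows "proper_map (top_of_set (ball 0 1)) (top_of_set (ball 0 1)) (ball_involution a)"
proof (rule homeomorphic_imp_proper_map, rule homeomorphic_maps_imp_map)
  show "homeomorphic_maps (top_of_set (ball 0 1)) (top_of_set (ball 0 1)) (ball_involution a) (ball_involution a)"
    unfolding homeomorphic_maps_def
    using assms holomorphic_map_imp_continuous_on[OF holomorphic_ball_involution[OF assms]]
    by (auto simp: ball_involution_in_ball)
qed

text \<open>The involutions are their own inverses, so the two maps that build the conjugate also
  recover \<open>F\<close> from it.\<close>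

lemma proper_holomorphic_ball_map_conjugate:
  assumes F: "proper_holomorphic_ball_map F" and a: "norm a < 1" and b: "norm b < 1"
  shows "proper_holomorphic_ball_map (ball_involution b \<circ> F \<circ> ball_involution a)"
    and "ball_maps_equivalent F (ball_involution b \<circ> F \<circ> ball_involution a)"
proof -
  have Fb: "norm (F z) < 1" if "norm z < 1" for z
    using F that unfolding proper_holomorphic_ball_map_def proper_map_ball_iff
    by (auto simp: image_subset_iff)
  have "holomorphic_map (ball_involution b \<circ> (F \<circ> ball_involution a)) (ball 0 1)"
    using F a b unfolding proper_holomorphic_ball_map_def
    by (intro holomorphic_map_compose[where T = "ball 0 1"] holomorphic_ball_involution)
      (auto simp: ball_involution_in_ball Fb)
  moreover have "proper_map (top_of_set (ball 0 1)) (top_of_set (ball 0 1))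
      (ball_involution b \<circ> (F \<circ> ball_involution a))"
    using F a b unfolding proper_holomorphic_ball_map_def
    by (intro proper_map_compose[OF proper_map_compose[OF proper_map_ball_involution[OF a]]
          proper_map_ball_involution[OF b], unfolded o_assoc[symmetric]]) auto
  ultimately show "proper_holomorphic_ball_map (ball_involution b \<circ> F \<circ> ball_involution a)"
    unfolding proper_holomorphic_ball_map_def by (simp add: o_assoc)
  show "ball_maps_equivalent F (ball_involution b \<circ> F \<circ> ball_involution a)"
    unfolding ball_maps_equivalent_def
    using a b
    by (intro exI[of _ "ball_involution a"] exI[of _ "ball_involution b"])
      (auto simp: ball_automorphism_ball_involution ball_involution_in_ball Fb)
qed

text \<open>Reduction to the disc: slice along the unit vector \<open>e\<close> in the direction of
  \<open>z\<close> and pair with the unit vector \<open>v\<close> in the direction of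
  \<open>F z\<close>. The resulting \<open>f\<close> is a self-map of the disc fixing 0.\<close>

lemma ball_map_Schwarz:
  fixes F :: "complex ^ 'n::finite \<Rightarrow> complex ^ 'm::finite"
  assumes hol: "holomorphic_map F (ball 0 1)"
    and bd: "\<And>z. norm z < 1 \<Longrightarrow> norm (F z) < 1" and F0: "F 0 = 0" and z: "norm z < 1"
  shows "norm (F z) \<le> norm z"
proof (cases "z = 0 \<or> F z = 0")
  case False
  define e where "e = of_real (inverse (norm z)) *s z"
  define v where "v = of_real (inverse (norm (F z))) *s F z"
  have e: "norm e = 1" and v: "norm v = 1"
    using False by (simp_all add: e_def v_def norm_vector_scale norm_inverse)
  define f where "f \<zeta> = cin (F (\<zeta> *s e)) v" for \<zeta>
  have "norm (f (of_real (norm z))) \<le> norm (complex_of_real (norm z))"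
  proof (rule Schwarz_Lemma(1))
    show "f holomorphic_on ball 0 1"
      unfolding holomorphic_on_def
    proof
      fix \<zeta> :: complex assume "\<zeta> \<in> ball 0 1"
      then have "\<zeta> *s e \<in> ball 0 1"
        by (simp add: norm_vector_scale e)
      then obtain F' where F': "(F has_derivative F') (at (\<zeta> *s e))"
          "Vector_Spaces.linear (*s) (*s) F'"
        using hol unfolding holomorphic_map_def by blast
      have bl: "bounded_linear (\<lambda>\<mu>. \<mu> *s e)"
      proof (rule bounded_linear_intro[where K = 1])
        show "(r *\<^sub>R x) *s e = r *\<^sub>R (x *s e)" for r :: real and x :: complex
          by (simp add: vec_eq_iff)
      qed (simp_all add: vec.scale_left_distrib norm_vector_scale e)
      have 1: "((\<lambda>\<mu>. F (\<mu> *s e)) has_derivative (\<lambda>\<mu>. F' (\<mu> *s e))) (at \<zeta>)"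
        using diff_chain_at[OF bounded_linear_imp_has_derivative[OF bl] F'(1)] by (simp add: o_def)
      have "(f has_derivative (\<lambda>\<mu>. cin (F' (\<mu> *s e)) v)) (at \<zeta>)"
        unfolding f_def cin_def
        by (intro derivative_intros bounded_linear.has_derivative[OF bounded_linear_vec_nth 1])
      moreover have "cin (F' (\<mu> *s e)) v = cin (F' e) v * \<mu>" for \<mu>
        using F'(2) by (simp add: complex_linear_iff cin_simps)
      ultimately have "(f has_field_derivative cin (F' e) v) (at \<zeta>)"
        by (simp add: has_field_derivative_def)
      then show "f field_differentiable at \<zeta> within ball 0 1"
        using field_differentiable_at_within field_differentiable_def by blast
    qed
    show "f 0 = 0"
      by (simp add: f_def F0)
    show "norm (f \<zeta>) < 1" if "norm \<zeta> < 1" for \<zeta>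
      unfolding f_def using that v by (intro norm_cin_less_1 bd) (simp_all add: norm_vector_scale e)
  qed (use z in simp)
  moreover have "of_real (norm z) *s e = z"
    using False by (simp add: e_def vec_eq_iff)
  moreover have "cin (F z) v = of_real (norm (F z))"
    using False by (simp add: v_def cin_simps cin_self power2_eq_square)
  ultimately show ?thesis
    by (simp add: f_def)
qed (use F0 in auto)

text \<open>Following \<open>F\<close> by the involution at \<open>b = F 0\<close> makes the Schwarz
  lemma applicable. The constant comes from \<open>norm_ball_involution\<close> and the bound
  \<open>1 - norm b \<le> norm (1 - cin (F z) b)\<close>. With \<open>F = p / q\<close> this will
  bound the cofactor \<open>A z z\<close> below by a multiple of |q|^2.\<close>

lemma ball_map_boundary_distance:
  fixes F :: "complex ^ 'n::finite \<Rightarrow> complex ^ 'm::finite"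
  assumes hol: "holomorphic_map F (ball 0 1)" and bd: "\<And>z. norm z < 1 \<Longrightarrow> norm (F z) < 1"
  obtains c where "c > 0" "\<And>z. norm z < 1 \<Longrightarrow> c * (1 - (norm z)\<^sup>2) \<le> 1 - (norm (F z))\<^sup>2"
proof
  define b where "b = F 0"
  have b: "norm b < 1"
    unfolding b_def by (rule bd) simp
  then have b2: "1 - (norm b)\<^sup>2 > 0"
    by (simp add: power_less_one_iff)
  define c where "c = (1 - norm b)\<^sup>2 / (1 - (norm b)\<^sup>2)"
  show "c > 0"
    unfolding c_def using b b2 by simp
  show "c * (1 - (norm z)\<^sup>2) \<le> 1 - (norm (F z))\<^sup>2" if z: "norm z < 1" for z
  proof -
    let ?\<Phi> = "ball_involution b \<circ> F"
    have "norm (?\<Phi> z) \<le> norm z"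
    proof (rule ball_map_Schwarz[OF _ _ _ z])
      show "holomorphic_map ?\<Phi> (ball 0 1)"
        using b bd by (intro holomorphic_map_compose[OF hol holomorphic_ball_involution]) auto
      show "norm (?\<Phi> z) < 1" if "norm z < 1" for z
        using that b bd by (simp add: ball_involution_in_ball)
      have "ball_involution b 0 = b"
        by (simp add: ball_involution_def)
      then have "ball_involution b b = 0"
        using ball_involution_involutive(2)[OF b, of 0] by simp
      then show "?\<Phi> 0 = 0"
        by (simp add: b_def)
    qed
    then have "1 - (norm z)\<^sup>2 \<le> 1 - (norm (?\<Phi> z))\<^sup>2"
      by (simp add: power_mono)
    also have "\<dots> = (1 - (norm b)\<^sup>2) * (1 - (norm (F z))\<^sup>2) / (norm (1 - cin (F z) b))\<^sup>2"
      using norm_ball_involution[OF b bd[OF z]] by simp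
    finally have 1: "1 - (norm z)\<^sup>2 \<le> \<dots>" .
    have "norm (cin (F z) b) \<le> norm b"
      using norm_cin_le[of "F z" b] bd[OF z] mult_left_le_one_le[of "norm b" "norm (F z)"] by simp
    then have 2: "1 - norm b \<le> norm (1 - cin (F z) b)"
      using norm_triangle_ineq2[of 1 "cin (F z) b"] by simp
    have "(1 - norm b)\<^sup>2 * (1 - (norm z)\<^sup>2) \<le> (norm (1 - cin (F z) b))\<^sup>2 * (1 - (norm z)\<^sup>2)"
      using 2 b z by (intro mult_right_mono power_mono) (auto simp: power_le_one_iff)
    also have "\<dots> \<le> (1 - (norm b)\<^sup>2) * (1 - (norm (F z))\<^sup>2)"
    proof -
      have "(norm (1 - cin (F z) b))\<^sup>2 > 0"
        using 2 b by (intro zero_less_power) linarith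
      then show ?thesis
        using 1 by (simp add: pos_le_divide_eq mult.commute)
    qed
    finally show ?thesis
      unfolding c_def using b2 by (simp add: field_simps)
  qed
qed

section \<open>Polynomials of degree two in two variables\<close>

definition quad :: "(nat \<Rightarrow> complex) \<Rightarrow> complex ^ 2 \<Rightarrow> complex" where
  "quad c z = c 0 + c 1 * z $ 1 + c 2 * z $ 2 + c 3 * (z $ 1)\<^sup>2 + c 4 * (z $ 1 * z $ 2) + c 5 * (z $ 2)\<^sup>2"

definition expo :: "nat \<Rightarrow> nat \<Rightarrow> (2 \<Rightarrow>\<^sub>0 nat)" where
  "expo i j = Poly_Mapping.single 1 i + Poly_Mapping.single 2 j"

abbreviation monom2 :: "complex \<Rightarrow> nat \<Rightarrow> nat \<Rightarrow> 2 cpoly" where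
  "monom2 c i j \<equiv> Poly_Mapping.single (expo i j) c"

definition quad_poly :: "(nat \<Rightarrow> complex) \<Rightarrow> 2 cpoly" where
  "quad_poly c = monom2 (c 0) 0 0 + monom2 (c 1) 1 0 + monom2 (c 2) 0 1 +
     monom2 (c 3) 2 0 + monom2 (c 4) 1 1 + monom2 (c 5) 0 2"

lemma lookup_expo [simp]:
  "Poly_Mapping.lookup (expo i j) 1 = i" "Poly_Mapping.lookup (expo i j) 2 = j"
proof -
  have "(2 :: 2) \<noteq> 1"
    by simp
  then show "Poly_Mapping.lookup (expo i j) 1 = i" "Poly_Mapping.lookup (expo i j) 2 = j"
    by (simp_all add: expo_def lookup_add lookup_single)
qed

lemma expo_eq_iff [simp]: "expo i j = expo k l \<longleftrightarrow> i = k \<and> j = l"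
  by (metis lookup_expo)

lemma expo_cases: "m = expo (Poly_Mapping.lookup m 1) (Poly_Mapping.lookup m 2)"
proof (rule poly_mapping_eqI)
  fix k :: 2
  show "Poly_Mapping.lookup m k =
    Poly_Mapping.lookup (expo (Poly_Mapping.lookup m 1) (Poly_Mapping.lookup m 2)) k"
    using exhaust_2[of k] by auto
qed

lemma eval_cpoly_superset:
  assumes "finite S" "Poly_Mapping.keys p \<subseteq> S"
  shows "eval_cpoly p z =
    (\<Sum>m\<in>S. Poly_Mapping.lookup p m * (\<Prod>i\<in>UNIV. (z $ i) ^ Poly_Mapping.lookup m i))"
  unfolding eval_cpoly_def
  using assms by (intro sum.mono_neutral_left) (auto simp: in_keys_iff)

lemma eval_cpoly_add: "eval_cpoly (p + q) z = eval_cpoly p z + eval_cpoly q z"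
proof -
  let ?S = "Poly_Mapping.keys p \<union> Poly_Mapping.keys q"
  have "finite ?S" "Poly_Mapping.keys (p + q) \<subseteq> ?S"
    using keys_add[of p q] by auto
  then show ?thesis
    by (simp add: eval_cpoly_superset[of ?S] lookup_add distrib_right sum.distrib)
qed

lemma eval_cpoly_monom2: "eval_cpoly (monom2 c i j) z = c * (z $ 1) ^ i * (z $ 2) ^ j"
proof -
  have "eval_cpoly (monom2 c i j) z = (\<Sum>m\<in>{expo i j}. Poly_Mapping.lookup (monom2 c i j) m *
      (\<Prod>i\<in>UNIV. (z $ i) ^ Poly_Mapping.lookup m i))"
    by (rule eval_cpoly_superset) auto
  then show ?thesis
    by (simp add: UNIV_2 mult.assoc)
qed

lemma eval_quad_poly: "eval_cpoly (quad_poly c) z = quad c z"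
  by (simp add: quad_poly_def quad_def eval_cpoly_add eval_cpoly_monom2)

lemma cpoly_degree_le_2:
  fixes p :: "2 cpoly"
  assumes "total_degree p \<le> 2"
  obtains c where "p = quad_poly c"
proof
  define c :: "nat \<Rightarrow> complex" where "c k = Poly_Mapping.lookup p
    (if k = 0 then expo 0 0 else if k = 1 then expo 1 0 else if k = 2 then expo 0 1
     else if k = 3 then expo 2 0 else if k = 4 then expo 1 1 else expo 0 2)" for k
  show "p = quad_poly c"
  proof (rule poly_mapping_eqI)
    fix m :: "2 \<Rightarrow>\<^sub>0 nat"
    obtain i j where m: "m = expo i j"
      using expo_cases by blast
    show "Poly_Mapping.lookup p m = Poly_Mapping.lookup (quad_poly c) m"
    proof (cases "i + j \<le> 2")
      case True
      then have "(i, j) \<in> {(0,0), (1,0), (0,1), (2,0), (1,1), (0,2)}"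
        by (cases i; cases j; force)
      then show ?thesis
        unfolding m quad_poly_def lookup_add lookup_single expo_eq_iff when_def
        by (auto simp: c_def)
    next
      case False
      have "m \<notin> Poly_Mapping.keys p"
      proof
        assume "m \<in> Poly_Mapping.keys p"
        then have "(\<Sum>i\<in>UNIV. Poly_Mapping.lookup m i) \<le> total_degree p"
          unfolding total_degree_def by (intro Max_ge) auto
        then show False
          using assms False by (simp add: m UNIV_2)
      qed
      then have "Poly_Mapping.lookup p m = 0"
        by (simp add: in_keys_iff)
      moreover have "Poly_Mapping.lookup (quad_poly c) m = 0"
        unfolding m quad_poly_def lookup_add lookup_single expo_eq_iff when_def using False by auto
      ultimately show ?thesis
        by simp
    qed
  qed
qed

lemma total_degree_0_eval:
  assumes "total_degree p = 0"
  shows "eval_cpoly p z = eval_cpoly p w"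
proof -
  have "Poly_Mapping.lookup m i = 0" if "m \<in> Poly_Mapping.keys p" for m i
  proof -
    have "(\<Sum>i\<in>UNIV. Poly_Mapping.lookup m i) \<le> total_degree p"
      unfolding total_degree_def using that by (intro Max_ge) auto
    then show ?thesis
      using assms by simp
  qed
  then show ?thesis
    unfolding eval_cpoly_def by simp
qed

section \<open>Divisibility by a linear form\<close>

lemma monom2_mult: "monom2 a i j * monom2 b k l = monom2 (a * b) (i + k) (j + l)"
  by (simp add: mult_single expo_def single_add add_ac)

text \<open>The hypotheses compare coefficients with the product of
  \<open>l0 + l1 z1 + l2 z2\<close> and \<open>u + v z1 + w z2\<close>, so that divisibility becomes
  six scalar equations.\<close>

lemma linear_mult_dvd_quad_poly:
  assumes "c 0 = l0 * u" "c 1 = l0 * v + l1 * u" "c 2 = l0 * w + l2 * u"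
    "c 3 = l1 * v" "c 4 = l1 * w + l2 * v" "c 5 = l2 * w"
  shows "monom2 l0 0 0 + monom2 l1 1 0 + monom2 l2 0 1 dvd quad_poly c"
proof
  show "quad_poly c = (monom2 l0 0 0 + monom2 l1 1 0 + monom2 l2 0 1) * (monom2 u 0 0 + monom2 v 1 0 + monom2 w 0 1)"
    unfolding quad_poly_def assms distrib_left distrib_right monom2_mult
    by (simp add: single_add add_ac numeral_2_eq_2)
qed

text \<open>
  The linear form that vanishes on the line through \<open>a\<close> with direction \<open>x\<close>.
\<close>

definition line_poly :: "complex ^ 2 \<Rightarrow> complex ^ 2 \<Rightarrow> 2 cpoly" where
  "line_poly a x = monom2 (x $ 1 * a $ 2 - x $ 2 * a $ 1) 0 0 + monom2 (x $ 2) 1 0 + monom2 (- (x $ 1)) 0 1"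

lemma total_degree_line_poly:
  assumes "x \<noteq> 0"
  shows "total_degree (line_poly a x) \<noteq> 0"
proof
  assume 0: "total_degree (line_poly a x) = 0"
  \<comment> \<open>The conjugated coefficients of the linear part are chosen so that this part
    takes the value |x1|^2 + |x2|^2 at \<open>y\<close>.\<close>
  define y :: "complex ^ 2" where "y = (\<chi> i. if i = 1 then cnj (x $ 2) else - cnj (x $ 1))"
  have y: "y $ 1 = cnj (x $ 2)" "y $ 2 = - cnj (x $ 1)"
    by (simp_all add: y_def)
  have "eval_cpoly (line_poly a x) y = eval_cpoly (line_poly a x) 0"
    by (rule total_degree_0_eval[OF 0])
  then have "x $ 2 * cnj (x $ 2) + x $ 1 * cnj (x $ 1) = 0"
    by (simp add: line_poly_def eval_cpoly_add eval_cpoly_monom2 y)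
  then have "complex_of_real ((norm (x $ 2))\<^sup>2 + (norm (x $ 1))\<^sup>2) = 0"
    by (simp only: complex_norm_square of_real_add)
  then have "(norm (x $ 2))\<^sup>2 + (norm (x $ 1))\<^sup>2 = 0"
    by (simp only: of_real_eq_0_iff)
  then have "x $ 1 = 0" "x $ 2 = 0"
    by (simp_all add: add_nonneg_eq_0_iff)
  with assms show False
    by (simp add: vec_eq_iff forall_2)
qed

lemma quad_on_line:
  "quad c (a + s *s x) = quad c a + s * ((c 1 + 2 * c 3 * a $ 1 + c 4 * a $ 2) * x $ 1
      + (c 2 + c 4 * a $ 1 + 2 * c 5 * a $ 2) * x $ 2)
    + s\<^sup>2 * (c 3 * (x $ 1)\<^sup>2 + c 4 * (x $ 1 * x $ 2) + c 5 * (x $ 2)\<^sup>2)"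
  by (simp add: quad_def algebra_simps power2_eq_square)

text \<open>On the line the polynomial is \<open>A + s B + s^2 C\<close>, so all three coefficients
  vanish. The cofactor is found by dividing by a nonzero coordinate of \<open>x\<close>: three of
  the coefficient equations define it, and the others follow from \<open>A\<close>, \<open>B\<close>
  and \<open>C\<close> being zero.\<close>

lemma line_poly_dvd:
  assumes "x \<noteq> 0" and zero: "\<And>s. quad c (a + s *s x) = 0"
  shows "line_poly a x dvd quad_poly c"
proof -
  define x1 x2 a1 a2 where "x1 = x $ 1" and "x2 = x $ 2" and "a1 = a $ 1" and "a2 = a $ 2"
  define A B C where "A = quad c a" and "B = (c 1 + 2 * c 3 * a1 + c 4 * a2) * x1
      + (c 2 + c 4 * a1 + 2 * c 5 * a2) * x2"
    and "C = c 3 * x1\<^sup>2 + c 4 * (x1 * x2) + c 5 * x2\<^sup>2"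
  have e: "A + s * B + s\<^sup>2 * C = 0" for s
    using zero[of s] unfolding quad_on_line A_def B_def C_def x1_def x2_def a1_def a2_def .
  have A: "A = 0"
    using e[of 0] by simp
  have BC: "B + C = 0" "C = B"
    using e[of 1] e[of "-1"] A by simp_all
  then have B: "B = 0" and C: "C = 0"
    by simp_all
  have A': "c 0 + c 1 * a1 + c 2 * a2 + c 3 * a1\<^sup>2 + c 4 * (a1 * a2) + c 5 * a2\<^sup>2 = 0"
    using A by (simp add: A_def quad_def a1_def a2_def)
  define l0 where "l0 = x1 * a2 - x2 * a1"
  have "monom2 l0 0 0 + monom2 x2 1 0 + monom2 (- x1) 0 1 dvd quad_poly c"
  proof (cases "x1 = 0")
    case False
    \<comment> \<open>The cofactor \<open>u + v z1 + w z2\<close> is read off from the coefficients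
      of z2^2, z1 z2 and z2, in this order.\<close>
    define w where "w = - c 5 / x1"
    define v where "v = (x2 * w - c 4) / x1"
    define u where "u = (l0 * w - c 2) / x1"
    have w: "x1 * w = - c 5" and v: "x1 * v = x2 * w - c 4" and u: "x1 * u = l0 * w - c 2"
      using False by (simp_all add: w_def v_def u_def)
    show ?thesis
    proof (rule linear_mult_dvd_quad_poly[where u = u and v = v and w = w])
      have "x1\<^sup>2 * (c 0 - l0 * u) = 0"
        using A' B C w v u unfolding l0_def B_def C_def by algebra
      then show "c 0 = l0 * u"
        using False by simp
      have "x1\<^sup>2 * (c 1 - (l0 * v + x2 * u)) = 0"
        using A' B C w v u unfolding l0_def B_def C_def by algebra
      then show "c 1 = l0 * v + x2 * u"
        using False by simp
      have "x1\<^sup>2 * (c 3 - x2 * v) = 0"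
        using C w v unfolding l0_def B_def C_def by algebra
      then show "c 3 = x2 * v"
        using False by simp
    qed (use w v u in \<open>simp_all add: algebra_simps\<close>)
  next
    case True
    then have x2: "x2 \<noteq> 0"
      using assms(1) by (auto simp: vec_eq_iff forall_2 x1_def x2_def)
    define v where "v = c 3 / x2"
    define w where "w = c 4 / x2"
    define u where "u = (c 1 - l0 * v) / x2"
    have w: "x2 * w = c 4" and v: "x2 * v = c 3" and u: "x2 * u = c 1 - l0 * v"
      using x2 by (simp_all add: w_def v_def u_def)
    show ?thesis
    proof (rule linear_mult_dvd_quad_poly[where u = u and v = v and w = w])
      have "x2\<^sup>2 * (c 0 - l0 * u) = 0"
        using A' B C w v u True unfolding l0_def B_def C_def by algebra
      then show "c 0 = l0 * u"
        using x2 by simp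
      have "x2\<^sup>2 * (c 2 - (l0 * w + - x1 * u)) = 0"
        using A' B C w v u True unfolding l0_def B_def C_def by algebra
      then show "c 2 = l0 * w + - x1 * u"
        using x2 by simp
      have "x2\<^sup>2 * (c 5 - - x1 * w) = 0"
        using C w v True unfolding l0_def B_def C_def by algebra
      then show "c 5 = - x1 * w"
        using x2 by (simp add: eq_neg_iff_add_eq_0)
    qed (use w v u True in \<open>simp_all add: algebra_simps\<close>)
  qed
  then show ?thesis
    unfolding line_poly_def l0_def x1_def x2_def a1_def a2_def .
qed

section \<open>Factorisation of Hermitian forms vanishing on the sphere\<close>

lemma infinite_unit_circle: "infinite {z :: complex. norm z = 1}"
proof
  assume "finite {z :: complex. norm z = 1}"
  moreover have "{z :: complex. norm z = 1} = sphere 0 1"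
    by (auto simp: sphere_def)
  moreover have "connected (sphere (0 :: complex) 1)"
    by (rule connected_sphere) simp
  ultimately obtain a where "sphere (0 :: complex) 1 = {a}"
    using connected_finite_iff_sing[of "sphere (0 :: complex) 1"] by auto
  moreover have "1 \<in> sphere (0 :: complex) 1" "- 1 \<in> sphere (0 :: complex) 1"
    by simp_all
  ultimately show False
    by (metis one_neq_neg_one singletonD)
qed

text \<open>A nonzero polynomial has finitely many roots. Degree four is what arises when a form of
  bidegree at most (2, 2) is restricted to a circle and multiplied by \<mu>^2.\<close>

lemma quartic_zero_on_circle:
  fixes a0 a1 a2 a3 a4 :: complex
  assumes "\<And>\<mu>. norm \<mu> = 1 \<Longrightarrow> a0 + a1 * \<mu> + a2 * \<mu>\<^sup>2 + a3 * \<mu> ^ 3 + a4 * \<mu> ^ 4 = 0"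
  shows "a0 = 0" "a1 = 0" "a2 = 0" "a3 = 0" "a4 = 0"
proof -
  define c where "c i = [a0, a1, a2, a3, a4] ! i" for i
  have sum: "(\<Sum>i\<le>4. c i * \<mu> ^ i) = a0 + a1 * \<mu> + a2 * \<mu>\<^sup>2 + a3 * \<mu> ^ 3 + a4 * \<mu> ^ 4" for \<mu>
    by (simp add: c_def eval_nat_numeral)
  have "{\<mu>. norm \<mu> = 1} \<subseteq> {\<mu>. (\<Sum>i\<le>4. c i * \<mu> ^ i) = 0}"
    using assms by (auto simp: sum)
  then have "infinite {\<mu>. (\<Sum>i\<le>4. c i * \<mu> ^ i) = 0}"
    using infinite_unit_circle finite_subset by blast
  then have "c k = 0" if "k \<le> 4" for k
    using polyfun_rootbound_finite[where c = c and n = 4] that by blast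
  from this[of 0] this[of 1] this[of 2] this[of 3] this[of 4]
  show "a0 = 0" "a1 = 0" "a2 = 0" "a3 = 0" "a4 = 0"
    by (simp_all add: c_def eval_nat_numeral)
qed

text \<open>
  \<open>S y z\<close> is the coefficient of \<open>\<mu>\<^sup>2\<close> (and of no conjugate of \<open>\<mu>\<close>) in the expansion of
  \<open>S (z + \<mu> y) (z + \<mu> y)\<close>; on the circle \<open>|\<mu>| = 1\<close> it is the only coefficient of that weight.
\<close>

lemma polarization:
  fixes S :: "complex ^ 'n::finite \<Rightarrow> complex ^ 'n \<Rightarrow> complex"
  assumes diag: "\<And>z. S z z = 0"
    and left: "\<And>z y w \<mu>. S (z + \<mu> *s y) w = S z w + \<mu> * (S (z + y) w - S z w - S y w) + \<mu>\<^sup>2 * S y w"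
    and right: "\<And>u z y \<mu>. S u (z + \<mu> *s y) = S u z + cnj \<mu> * E u z y + (cnj \<mu>)\<^sup>2 * E' u z y"
  shows "S y z = 0"
proof (rule quartic_zero_on_circle(5))
  fix \<mu> :: complex assume "norm \<mu> = 1"
  then have \<mu>: "\<mu> * cnj \<mu> = 1"
    using complex_norm_square[of \<mu>] by simp
  \<comment> \<open>The factor \<mu>^2 removes all conjugates of \<mu> and moves
    \<open>S y z\<close> to the power four.\<close>
  have "0 = \<mu>\<^sup>2 * S (z + \<mu> *s y) (z + \<mu> *s y)"
    by (simp add: diag)
  also have "\<dots> = E' z z y + (E z z y + (E' (z + y) z y - E' z z y - E' y z y)) * \<mu>
      + (S z z + (E (z + y) z y - E z z y - E y z y) + E' y z y) * \<mu>\<^sup>2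
      + ((S (z + y) z - S z z - S y z) + E y z y) * \<mu> ^ 3 + S y z * \<mu> ^ 4"
    unfolding left[of z \<mu> y "z + \<mu> *s y"] unfolding right using \<mu> by algebra
  finally show "E' z z y + (E z z y + (E' (z + y) z y - E' z z y - E' y z y)) * \<mu>
      + (S z z + (E (z + y) z y - E z z y - E y z y) + E' y z y) * \<mu>\<^sup>2
      + ((S (z + y) z - S z z - S y z) + E y z y) * \<mu> ^ 3 + S y z * \<mu> ^ 4 = 0"
    by simp
qed

text \<open>A quadratic form seen through its restrictions to lines, with the polar form as middle
  coefficient. This is the shape of the hypothesis \<open>left\<close> of
  \<open>polarization\<close>, and it passes to sums and multiples without naming
  coefficients.\<close>

definition hom_quad :: "(complex ^ 'n::finite \<Rightarrow> complex) \<Rightarrow> bool" where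
  "hom_quad f \<longleftrightarrow> (\<forall>z y \<mu>. f (z + \<mu> *s y) = f z + \<mu> * (f (z + y) - f z - f y) + \<mu>\<^sup>2 * f y)"

lemma hom_quadD: "hom_quad f \<Longrightarrow> f (z + \<mu> *s y) = f z + \<mu> * (f (z + y) - f z - f y) + \<mu>\<^sup>2 * f y"
  by (simp add: hom_quad_def)

lemma hom_quad_add:
  assumes "hom_quad f" "hom_quad g"
  shows "hom_quad (\<lambda>z. f z + g z)"
  unfolding hom_quad_def hom_quadD[OF assms(1)] hom_quadD[OF assms(2)] by (simp add: algebra_simps)

lemma hom_quad_diff:
  assumes "hom_quad f" "hom_quad g"
  shows "hom_quad (\<lambda>z. f z - g z)"
  unfolding hom_quad_def hom_quadD[OF assms(1)] hom_quadD[OF assms(2)] by (simp add: algebra_simps)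

lemma hom_quad_mult_const:
  assumes "hom_quad f"
  shows "hom_quad (\<lambda>z. f z * k)"
  unfolding hom_quad_def hom_quadD[OF assms(1)] by (simp add: algebra_simps)

lemma hom_quad_sum: "(\<And>i. i \<in> I \<Longrightarrow> hom_quad (f i)) \<Longrightarrow> hom_quad (\<lambda>z. \<Sum>i\<in>I. f i z)"
proof (induction I rule: infinite_finite_induct)
  case (insert i I)
  then show ?case
    by (simp add: hom_quad_add)
qed (simp_all add: hom_quad_def)

lemma hom_quad_mult:
  assumes f: "\<And>z y \<mu>. f (z + \<mu> *s y) = f z + \<mu> * f y" and g: "\<And>z y \<mu>. g (z + \<mu> *s y) = g z + \<mu> * g y"
  shows "hom_quad (\<lambda>z. f z * g z)"
proof -
  have "f (z + y) = f z + f y" "g (z + y) = g z + g y" for z y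
    using f[of z 1 y] g[of z 1 y] by simp_all
  then show ?thesis
    unfolding hom_quad_def f g by (simp add: algebra_simps power2_eq_square)
qed

text \<open>The homogeneous components of \<open>quad c\<close>. Every index from 2 on gives the
  quadratic one, hence the bound \<open>k \<le> 2\<close> in the scaling laws.\<close>

definition qpart :: "(nat \<Rightarrow> complex) \<Rightarrow> nat \<Rightarrow> complex ^ 2 \<Rightarrow> complex" where
  "qpart c k z = (if k = 0 then c 0 else if k = 1 then c 1 * z $ 1 + c 2 * z $ 2
     else c 3 * (z $ 1)\<^sup>2 + c 4 * (z $ 1 * z $ 2) + c 5 * (z $ 2)\<^sup>2)"

lemma quad_eq_qpart: "quad c z = qpart c 0 z + qpart c 1 z + qpart c 2 z"
  by (simp add: quad_def qpart_def)

lemma qpart_0: "qpart c 0 z = c 0"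
  by (simp add: qpart_def)

lemma qpart_1: "qpart c 1 (z + \<mu> *s y) = qpart c 1 z + \<mu> * qpart c 1 y"
  by (simp add: qpart_def algebra_simps)

lemma qpart_2: "hom_quad (qpart c 2)"
  by (simp add: hom_quad_def qpart_def algebra_simps power2_eq_square)

lemma qpart_scale: "k \<le> 2 \<Longrightarrow> qpart c k (\<mu> *s z) = \<mu> ^ k * qpart c k z"
  by (auto simp: qpart_def algebra_simps power2_eq_square le_Suc_eq numeral_2_eq_2)

lemma continuous_on_qpart [continuous_intros]:
  "continuous_on S f \<Longrightarrow> continuous_on S (\<lambda>x. qpart c k (f x))"
  unfolding qpart_def by (cases "k = 0"; cases "k = 1") (auto intro!: continuous_intros)

context
  fixes c :: "nat \<Rightarrow> complex" and d :: "'m::finite \<Rightarrow> nat \<Rightarrow> complex"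
begin

text \<open>The component of bidegree (j, k) of the polarised form
  \<open>q(z) cnj (q(w)) - cin (p z) (p w)\<close>, where \<open>c\<close> describes
  \<open>q\<close> and \<open>d\<close> the components of \<open>p\<close>.\<close>

definition hpart :: "nat \<Rightarrow> nat \<Rightarrow> complex ^ 2 \<Rightarrow> complex ^ 2 \<Rightarrow> complex" where
  "hpart j k z w = qpart c j z * cnj (qpart c k w) - (\<Sum>i\<in>UNIV. qpart (d i) j z * cnj (qpart (d i) k w))"

lemma cnj_hpart: "cnj (hpart j k z w) = hpart k j w z"
  by (simp add: hpart_def mult.commute)

lemma hpart_scale: "j \<le> 2 \<Longrightarrow> k \<le> 2 \<Longrightarrow> hpart j k (\<mu> *s z) (\<nu> *s w) = \<mu> ^ j * cnj \<nu> ^ k * hpart j k z w"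
  by (simp add: hpart_def qpart_scale right_diff_distrib sum_distrib_left mult_ac)

lemma hpart_1_left: "hpart 1 k (z + \<mu> *s y) w = hpart 1 k z w + \<mu> * hpart 1 k y w"
  unfolding hpart_def qpart_1 by (simp add: algebra_simps sum.distrib sum_distrib_left)

lemma hpart_1_right: "hpart k 1 w (z + \<mu> *s y) = hpart k 1 w z + cnj \<mu> * hpart k 1 w y"
  using arg_cong[OF hpart_1_left[of k z \<mu> y w], of cnj] by (simp add: cnj_hpart)

lemma hpart_0_left: "hpart 0 k z w = hpart 0 k 0 w"
  by (simp add: hpart_def qpart_0)

lemma hpart_0_right: "hpart k 0 z w = hpart k 0 z 0"
  by (simp add: hpart_def qpart_0)

lemma hom_quad_hpart: "hom_quad (\<lambda>z. hpart 2 k z w)"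
  unfolding hpart_def by (intro hom_quad_diff hom_quad_mult_const hom_quad_sum qpart_2)

lemma hermitian_form_eq_hpart:
  "quad c z * cnj (quad c w) - (\<Sum>i\<in>UNIV. quad (d i) z * cnj (quad (d i) w)) =
    hpart 0 0 z w + hpart 0 1 z w + hpart 0 2 z w + hpart 1 0 z w + hpart 1 1 z w + hpart 1 2 z w +
    hpart 2 0 z w + hpart 2 1 z w + hpart 2 2 z w"
  unfolding quad_eq_qpart hpart_def by (simp add: algebra_simps sum.distrib)

context
  assumes sphere: "\<forall>z. norm z = 1 \<longrightarrow>
    quad c z * cnj (quad c z) - (\<Sum>i\<in>UNIV. quad (d i) z * cnj (quad (d i) z)) = 0"
begin

text \<open>
  The sphere is invariant under \<open>z \<mapsto> \<mu> z\<close> with \<open>|\<mu>| = 1\<close>, so the parts of different weight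
  vanish separately.
\<close>

lemma hpart_sphere:
  assumes z: "norm z = 1"
  shows "hpart 2 0 z z = 0" "hpart 2 1 z z + hpart 1 0 z z = 0"
    "hpart 2 2 z z + hpart 1 1 z z + hpart 0 0 z z = 0"
proof -
  \<comment> \<open>After multiplication by \<mu>^2, \<open>hpart j k\<close> stands at the power
    \<open>2 + j - k\<close>.\<close>
  have *: "hpart 0 2 z z + (hpart 0 1 z z + hpart 1 2 z z) * \<mu>
     + (hpart 2 2 z z + hpart 1 1 z z + hpart 0 0 z z) * \<mu>\<^sup>2
     + (hpart 2 1 z z + hpart 1 0 z z) * \<mu> ^ 3 + hpart 2 0 z z * \<mu> ^ 4 = 0" if "norm \<mu> = 1" for \<mu>
  proof -
    have \<mu>: "\<mu> * cnj \<mu> = 1"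
      using complex_norm_square[of \<mu>] that by simp
    have "norm (\<mu> *s z) = 1"
      using that z by (simp add: norm_vector_scale)
    from sphere[rule_format, OF this] have "hpart 0 0 z z + cnj \<mu> * hpart 0 1 z z + (cnj \<mu>)\<^sup>2 * hpart 0 2 z z
        + \<mu> * hpart 1 0 z z + \<mu> * cnj \<mu> * hpart 1 1 z z + \<mu> * (cnj \<mu>)\<^sup>2 * hpart 1 2 z z
        + \<mu>\<^sup>2 * hpart 2 0 z z + \<mu>\<^sup>2 * cnj \<mu> * hpart 2 1 z z + \<mu>\<^sup>2 * (cnj \<mu>)\<^sup>2 * hpart 2 2 z z = 0"
      unfolding hermitian_form_eq_hpart by (simp add: hpart_scale)
    then show ?thesis
      using \<mu> by algebra
  qed
  show "hpart 2 0 z z = 0" "hpart 2 1 z z + hpart 1 0 z z = 0"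
    "hpart 2 2 z z + hpart 1 1 z z + hpart 0 0 z z = 0"
    using quartic_zero_on_circle(5)[OF *] quartic_zero_on_circle(4)[OF *]
      quartic_zero_on_circle(3)[OF *] by simp_all
qed

text \<open>The relations on the sphere extend to all \<open>z\<close> by scaling: powers of
  \<open>cin z z\<close> make up for the different degrees of the terms. At \<open>z = 0\<close> any
  unit vector serves as \<open>u\<close>.\<close>

lemma hpart_diag:
  "hpart 2 0 z z = 0" "hpart 2 1 z z + cin z z * hpart 1 0 z z = 0"
  "hpart 2 2 z z + cin z z * hpart 1 1 z z + (cin z z)\<^sup>2 * hpart 0 0 z z = 0"
proof -
  define r where "r = complex_of_real (norm z)"
  have "\<exists>u. norm u = 1 \<and> z = r *s u"
  proof (cases "z = 0")
    case True
    have "norm (axis 1 1 :: complex ^ 2) = 1"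
      by (simp add: norm_axis_1)
    then show ?thesis
      using True by (intro exI[of _ "axis 1 1"]) (simp add: r_def)
  next
    case False
    then show ?thesis
      by (intro exI[of _ "inverse r *s z"]) (simp add: r_def norm_vector_scale norm_inverse)
  qed
  then obtain u where u: "norm u = 1" "z = r *s u"
    by blast
  have cr: "cnj r = r" and rr: "cin z z = r\<^sup>2"
    by (simp_all add: r_def cin_self)
  note s = hpart_sphere[OF u(1)]
  show "hpart 2 0 z z = 0"
    unfolding u(2) using s(1) by (simp add: hpart_scale)
  have "hpart 2 1 z z + cin z z * hpart 1 0 z z = r ^ 3 * (hpart 2 1 u u + hpart 1 0 u u)"
    unfolding rr unfolding u(2) by (simp add: hpart_scale cr algebra_simps power2_eq_square power3_eq_cube)
  then show "hpart 2 1 z z + cin z z * hpart 1 0 z z = 0"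
    by (simp only: s mult_zero_right)
  have "hpart 2 2 z z + cin z z * hpart 1 1 z z + (cin z z)\<^sup>2 * hpart 0 0 z z =
      r ^ 4 * (hpart 2 2 u u + hpart 1 1 u u + hpart 0 0 u u)"
    unfolding rr unfolding u(2) by (simp add: hpart_scale cr algebra_simps power2_eq_square power4_eq_xxxx)
  then show "hpart 2 2 z z + cin z z * hpart 1 1 z z + (cin z z)\<^sup>2 * hpart 0 0 z z = 0"
    by (simp only: s mult_zero_right)
qed

lemma hpart_20: "hpart 2 0 z w = 0"
  using hpart_diag(1)[of z] hpart_0_right by metis

text \<open>Polarisation of the homogenised diagonal relation. \<open>S\<close> is only
  conjugate-linear in its second argument, so the quadratic coefficient \<open>E'\<close> is
  zero.\<close>

lemma hpart_21: "hpart 2 1 z w = - cin z w * hpart 1 0 z w"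
proof -
  define S where "S z w = hpart 2 1 z w + cin z w * hpart 1 0 z w" for z w
  have "S z w = 0"
  proof (rule polarization[where S = S and E = "\<lambda>u z y. S u y" and E' = "\<lambda>_ _ _. 0"])
    show "S z z = 0" for z
      unfolding S_def by (rule hpart_diag(2))
    have "hom_quad (\<lambda>z. cin z w * hpart 1 0 z w)" for w
      by (rule hom_quad_mult; simp only: hpart_1_left cin_simps)
    then have "hom_quad (\<lambda>z. S z w)" for w
      unfolding S_def by (simp only: hom_quad_add hom_quad_hpart)
    then show "S (z + \<mu> *s y) w = S z w + \<mu> * (S (z + y) w - S z w - S y w) + \<mu>\<^sup>2 * S y w" for z y w \<mu>
      by (simp add: hom_quad_def)
    show "S u (z + \<mu> *s y) = S u z + cnj \<mu> * S u y + (cnj \<mu>)\<^sup>2 * 0" for u z y \<mu>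
      unfolding S_def hpart_1_right hpart_0_right[of 1 u "z + \<mu> *s y"] hpart_0_right[of 1 u z]
        hpart_0_right[of 1 u y]
      by (simp add: cin_simps algebra_simps)
  qed
  then show ?thesis
    by (simp add: S_def add_eq_0_iff)
qed

text \<open>Here \<open>S\<close> is quadratic in both arguments; since it is Hermitian, the
  expansion on the right is the conjugate of the one on the left.\<close>

lemma hpart_22: "hpart 2 2 z w = - cin z w * hpart 1 1 z w - (cin z w)\<^sup>2 * hpart 0 0 z w"
proof -
  define S where "S z w = hpart 2 2 z w + cin z w * hpart 1 1 z w + cin z w * cin z w * hpart 0 0 0 0" for z w
  have h00: "hpart 0 0 z w = hpart 0 0 0 0" for z w
    using hpart_0_left hpart_0_right by metis
  have cnjS: "cnj (S z w) = S w z" for z w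
    by (simp add: S_def cnj_hpart cnj_cin)
  have left: "S (z + \<mu> *s y) w = S z w + \<mu> * (S (z + y) w - S z w - S y w) + \<mu>\<^sup>2 * S y w" for z y w \<mu>
  proof -
    have "hom_quad (\<lambda>z. cin z w * hpart 1 1 z w)" "hom_quad (\<lambda>z. cin z w * cin z w)"
      by (rule hom_quad_mult; simp only: hpart_1_left cin_simps)+
    then have "hom_quad (\<lambda>z. S z w)"
      unfolding S_def by (simp only: hom_quad_add hom_quad_hpart hom_quad_mult_const)
    then show ?thesis
      by (simp add: hom_quad_def)
  qed
  have "S z w = 0"
  proof (rule polarization[where S = S and E = "\<lambda>u z y. S u (z + y) - S u z - S u y"
        and E' = "\<lambda>u z y. S u y"])
    show "S z z = 0" for z
      using hpart_diag(3)[of z] by (simp add: S_def h00[of z z] power2_eq_square)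
    show "S (z + \<mu> *s y) w = S z w + \<mu> * (S (z + y) w - S z w - S y w) + \<mu>\<^sup>2 * S y w" for z y w \<mu>
      by (rule left)
    show "S u (z + \<mu> *s y) = S u z + cnj \<mu> * (S u (z + y) - S u z - S u y) + (cnj \<mu>)\<^sup>2 * S u y" for u z y \<mu>
      using arg_cong[OF left[of z \<mu> y u], of cnj] by (simp add: cnjS)
  qed
  then show ?thesis
    unfolding S_def h00[of z w] by algebra
qed

text \<open>Substituting the relations for the parts of degree two and writing \<open>u\<close> for
  \<open>cin z w\<close>, the parts (1,0), (0,1) and (1,1) acquire the factor \<open>1 - u\<close>
  and the part (0,0) acquires \<open>1 - u^2\<close>. Dividing by \<open>1 - u\<close> gives
  \<open>A\<close>.\<close>

lemma sphere_factorization: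
  "\<exists>A. (\<forall>z w. quad c z * cnj (quad c w) - (\<Sum>i\<in>UNIV. quad (d i) z * cnj (quad (d i) w)) =
      (1 - cin z w) * A z w) \<and>
    (\<forall>z w s x. A (z + s *s x) w = A z w + s * (A (z + x) w - A z w)) \<and>
    (\<forall>z w. cnj (A z w) = A w z) \<and> continuous_on UNIV (\<lambda>z. A z z)"
proof -
  define A where "A z w = hpart 0 0 z w + hpart 1 0 z w + hpart 0 1 z w + hpart 1 1 z w +
    hpart 0 0 z w * cin z w" for z w
  have 12: "hpart 1 2 z w = - cin z w * hpart 0 1 z w" for z w
    using arg_cong[OF hpart_21[of w z], of cnj] by (simp add: cnj_hpart cnj_cin)
  have 02: "hpart 0 2 z w = 0" for z w
    using arg_cong[OF hpart_20[of w z], of cnj] by (simp add: cnj_hpart)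
  have 1: "quad c z * cnj (quad c w) - (\<Sum>i\<in>UNIV. quad (d i) z * cnj (quad (d i) w)) = (1 - cin z w) * A z w" for z w
    unfolding hermitian_form_eq_hpart A_def hpart_20 hpart_21 hpart_22 12 02
    by (simp add: algebra_simps power2_eq_square)
  have 2: "cnj (A z w) = A w z" for z w
    by (simp add: A_def cnj_hpart cnj_cin)
  have A: "A (z + s *s x) w - A z w = s * (hpart 1 0 x w + hpart 1 1 x w + hpart 0 0 0 w * cin x w)" for z w s x
    unfolding A_def hpart_1_left hpart_0_left[of _ "z + s *s x"] hpart_0_left[of _ z]
    by (simp add: cin_simps algebra_simps)
  have 3: "A (z + s *s x) w = A z w + s * (A (z + x) w - A z w)" for z w s x
    using A[of z s x w] A[of z 1 x w] by (simp add: diff_eq_eq add.commute)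
  have 4: "continuous_on UNIV (\<lambda>z. A z z)"
    unfolding A_def hpart_def by (intro continuous_intros)
  show ?thesis
    by (intro exI[of _ A] conjI allI 1 2 3 4)
qed

end

end

section \<open>The pencil of the two Hermitian forms\<close>

text \<open>The bidisc of radius 1/3 lies in the ball, and values at a few of its points determine
  all six coefficients.\<close>

lemma quad_poly_nonzero_point:
  assumes "quad_poly c \<noteq> 0"
  obtains w where "norm w < 1" "quad c w \<noteq> 0"
proof -
  have "\<exists>w. norm w < 1 \<and> quad c w \<noteq> 0"
  proof (rule ccontr)
    assume "\<not> ?thesis"
    then have z: "quad c w = 0" if "norm w < 1" for w
      using that by blast
    have 0: "c 0 + c 1 * x + c 2 * y + c 3 * x\<^sup>2 + c 4 * (x * y) + c 5 * y\<^sup>2 = 0"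
      if "norm x \<le> 1/3" "norm y \<le> 1/3" for x y
    proof -
      define w :: "complex ^ 2" where "w = (\<chi> i. if i = 1 then x else y)"
      have w: "w $ 1 = x" "w $ 2 = y"
        by (simp_all add: w_def)
      have "norm w \<le> (\<Sum>i\<in>UNIV. norm (w $ i))"
        by (simp add: norm_vec_def L2_set_le_sum)
      also have "\<dots> < 1"
        using that by (simp add: UNIV_2 w)
      finally show ?thesis
        using z[of w] by (simp add: quad_def w)
    qed
    \<comment> \<open>The points 0 and 1/3, -1/3 on each axis settle every coefficient except that
      of the mixed term.\<close>
    have *: "c 0 = 0" "c 1 = 0" "c 2 = 0" "c 3 = 0" "c 5 = 0"
      using 0[of 0 0] 0[of "1/3" 0] 0[of "-1/3" 0] 0[of 0 "1/3"] 0[of 0 "-1/3"]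
      by (simp_all add: power2_eq_square add_eq_0_iff)
    moreover have "c 4 = 0"
      using 0[of "1/3" "1/3"] * by simp
    ultimately have "quad_poly c = 0"
      unfolding quad_poly_def by simp
    with assms show False
      by simp
  qed
  with that show ?thesis
    by blast
qed

lemma quad_on_line_qpart:
  "quad c (a + s *s x) = quad c a + s * ((c 1 + 2 * c 3 * a $ 1 + c 4 * a $ 2) * x $ 1
      + (c 2 + c 4 * a $ 1 + 2 * c 5 * a $ 2) * x $ 2) + s\<^sup>2 * qpart c 2 x"
  unfolding quad_on_line by (simp add: qpart_def)

lemma tendsto_segment:
  fixes z w :: "complex ^ 'n::finite"
  shows "((\<lambda>t. z + complex_of_real t *s (w - z)) \<longlongrightarrow> z) (at_right 0)"
proof -
  have "((\<lambda>t. z + complex_of_real t *s (w - z)) \<longlongrightarrow> z + complex_of_real 0 *s (w - z)) (at_right 0)"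
    by (intro vec_tendstoI) (auto intro!: tendsto_eq_intros)
  then show ?thesis
    by simp
qed

text \<open>Along the segment \<open>quad c\<close> is a polynomial in \<open>s\<close> that is
  nonzero at \<open>s = 1\<close>, so it has finitely many zeros. Every point of the closed ball,
  even a zero of the denominator, can thus be approached through points where the quotient is
  defined.\<close>

lemma eventually_segment_nonzero:
  assumes w: "norm w < 1" "quad c w \<noteq> 0" and z: "norm z \<le> 1"
  shows "\<forall>\<^sub>F t in at_right 0. norm (z + complex_of_real t *s (w - z)) < 1 \<and>
    quad c (z + complex_of_real t *s (w - z)) \<noteq> 0"
proof -
  have "\<exists>a0 a1 a2. \<forall>s. quad c (z + s *s (w - z)) = a0 + s * a1 + s\<^sup>2 * a2"
    unfolding quad_on_line by (intro exI allI) (rule refl)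
  then obtain a0 a1 a2 where a: "\<And>s. quad c (z + s *s (w - z)) = a0 + s * a1 + s\<^sup>2 * a2"
    by blast
  define e where "e i = [a0, a1, a2] ! i" for i
  have e: "(\<Sum>i\<le>2. e i * s ^ i) = quad c (z + s *s (w - z))" for s
    unfolding a by (simp add: e_def eval_nat_numeral mult.commute)
  have "\<exists>k\<le>2. e k \<noteq> 0"
  proof (rule ccontr)
    assume "\<not> ?thesis"
    then have "quad c (z + 1 *s (w - z)) = 0"
      unfolding e[symmetric] by simp
    with w show False
      by simp
  qed
  then have "finite {s. quad c (z + s *s (w - z)) = 0}"
    unfolding e[symmetric] by (rule polyfun_rootbound_finite)
  then have "finite (complex_of_real -` {s. quad c (z + s *s (w - z)) = 0})"
    by (intro finite_vimageI) (auto simp: inj_def)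
  then have "\<forall>\<^sub>F t in at_right 0. \<forall>u\<in>complex_of_real -` {s. quad c (z + s *s (w - z)) = 0}. t \<noteq> u"
    by (rule eventually_ball_finite) (blast intro: eventually_neq_at_within)
  moreover have "\<forall>\<^sub>F t in at_right 0. (0::real) < t \<and> t \<le> 1"
    unfolding eventually_at_right_field by (intro exI[of _ 1]) auto
  ultimately show ?thesis
  proof eventually_elim
    case (elim t)
    have "z + complex_of_real t *s (w - z) = complex_of_real (1 - t) *s z + complex_of_real t *s w"
      by (simp add: vec_eq_iff algebra_simps)
    then have "norm (z + complex_of_real t *s (w - z)) \<le>
        norm (complex_of_real (1 - t) *s z) + norm (complex_of_real t *s w)"
      by (metis norm_triangle_ineq)
    also have "\<dots> = (1 - t) * norm z + t * norm w"
      using elim unfolding norm_vector_scale norm_of_real by simp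
    also have "\<dots> \<le> (1 - t) * 1 + t * norm w"
      using elim z by (intro add_mono mult_left_mono) auto
    also have "\<dots> < (1 - t) * 1 + t * 1"
      using elim w by (intro add_strict_left_mono mult_strict_left_mono) auto
    finally show ?case
      using elim by auto
  qed
qed

text \<open>Off the hyperplane \<open>cin z a = 1\<close> the factor cancels. From a point on it,
  \<open>z + a\<close> and \<open>z - a\<close> both lie off it, and affinity makes
  \<open>g z\<close> the mean of the two values there.\<close>

lemma affine_mult_eq_0:
  fixes g :: "complex ^ 'n::finite \<Rightarrow> complex"
  assumes aff: "\<And>z s x. g (z + s *s x) = g z + s * (g (z + x) - g z)"
    and zero: "\<And>z. (1 - cin z a) * g z = 0"
  shows "g z = 0"
proof (cases "cin z a = 1")
  case True
  then have "a \<noteq> 0"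
    by auto
  then have a: "cin a a \<noteq> 0"
    by (simp add: cin_self)
  have "g (z + s *s a) = 0" if "s \<noteq> 0" for s
    using zero[of "z + s *s a"] that a True by (simp add: cin_simps)
  from this[of 1] this[of "-1"] show ?thesis
    using aff[of z "-1" a] by simp
next
  case False
  then show ?thesis
    using zero[of z] by simp
qed

text \<open>The data of \<open>p / q\<close> and of the cofactor \<open>A\<close>, without the map
  \<open>F\<close> itself. Affinity in the second argument, up to conjugation, comes from
  \<open>hermitian\<close>.\<close>

locale quadratic_ball_quotient =
  fixes c :: "nat \<Rightarrow> complex" and d :: "'m::finite \<Rightarrow> nat \<Rightarrow> complex"
    and A :: "complex ^ 2 \<Rightarrow> complex ^ 2 \<Rightarrow> complex"
    and p :: "complex ^ 2 \<Rightarrow> complex ^ 'm"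
  assumes p_def: "p z = (\<chi> i. quad (d i) z)"
    and factor: "quad c z * cnj (quad c w) - cin (p z) (p w) = (1 - cin z w) * A z w"
    and affine: "A (z + s *s x) w = A z w + s * (A (z + x) w - A z w)"
    and hermitian: "cnj (A z w) = A w z"
    and nonneg: "norm z \<le> 1 \<Longrightarrow> 0 \<le> Re (A z z)"
    and interior: "\<exists>w. norm w < 1 \<and> norm (p w) < norm (quad c w)"
begin

lemma factor_diag: "(norm (quad c z))\<^sup>2 - (norm (p z))\<^sup>2 = (1 - (norm z)\<^sup>2) * Re (A z z)"
  using arg_cong[OF factor[of z z], of Re]
  unfolding cin_self complex_norm_square[symmetric] by simp

text \<open>
  The linear parts at \<open>z0\<close> have Gram matrix \<open>(1 - |z0|\<^sup>2) A\<close>, which is positive semidefinite,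
  whereas a direction \<open>x\<close> in the kernel of the linear part of the denominator gives it the
  value \<open>- |dp x|\<^sup>2\<close>. Thus \<open>dp x = 0\<close>, which puts \<open>z0 + x\<close> in the kernel of \<open>A\<close>.
\<close>

lemma null_line:
  assumes z0: "norm z0 \<le> 1" "A z0 z0 = 0" "quad c z0 = 0"
  shows "\<exists>x. x \<noteq> 0 \<and> (\<forall>s. quad c (z0 + s *s x) = 0 \<and> p (z0 + s *s x) = 0)"
proof -
  define dq :: "(nat \<Rightarrow> complex) \<Rightarrow> complex ^ 2 \<Rightarrow> complex" where "dq e x = (e 1 + 2 * e 3 * z0 $ 1 + e 4 * z0 $ 2) * x $ 1
      + (e 2 + e 4 * z0 $ 1 + 2 * e 5 * z0 $ 2) * x $ 2" for e x
  define dp p2 where "dp x = (\<chi> i. dq (d i) x)" and "p2 x = (\<chi> i. qpart (d i) 2 x)" for x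
  have pz0: "p z0 = 0"
    using factor_diag[of z0] z0 by simp
  then have dz0: "quad (d i) z0 = 0" for i
    by (simp add: p_def vec_eq_iff)
  have q: "quad c (z0 + s *s x) = s * dq c x + s\<^sup>2 * qpart c 2 x" for s x
    unfolding quad_on_line_qpart z0 dq_def by simp
  have p: "p (z0 + s *s x) = s *s dp x + s\<^sup>2 *s p2 x" for s x
    unfolding p_def quad_on_line_qpart dz0 dp_def dq_def p2_def by (simp add: vec_eq_iff)
  have "(1 - cin z z0) * A z z0 = 0" for z
    using factor[of z z0] z0 pz0 by simp
  then have Az0: "A z z0 = 0" for z
    using affine_mult_eq_0[of "\<lambda>z. A z z0"] affine by blast
  then have Az0': "A z0 w = 0" for w
    using hermitian[of w z0] by simp
  have A: "A (z0 + s *s x) w = s * A (z0 + x) w" for s x w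
    using affine[of z0 s x w] Az0' by simp
  have A': "A w (z0 + s *s x) = cnj s * A w (z0 + x)" for s x w
    using arg_cong[OF A[of s x w], of cnj] hermitian by simp
  \<comment> \<open>Half the difference of the cases \<open>s = 1\<close> and \<open>s = -1\<close>
    isolates the part linear in \<open>s\<close>; \<open>second\<close> does the same in the other
    argument.\<close>
  have first: "dq c x * cnj (quad c w) - cin (dp x) (p w) = (1 - cin z0 w) * A (z0 + x) w" for x w
    using factor[of "z0 + 1 *s x" w] factor[of "z0 + (-1) *s x" w]
    unfolding q p A cin_simps by simp algebra
  have second: "dq c x * cnj (dq c y) - cin (dp x) (dp y) = (1 - cin z0 z0) * A (z0 + x) (z0 + y)" for x y
    using first[of x "z0 + 1 *s y"] first[of x "z0 + (-1) *s y"]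
    unfolding q p A' cin_simps complex_cnj_mult complex_cnj_add by simp algebra
  obtain x where x: "x \<noteq> 0" "dq c x = 0"
  proof -
    define \<alpha> \<beta> where "\<alpha> = c 1 + 2 * c 3 * z0 $ 1 + c 4 * z0 $ 2" and "\<beta> = c 2 + c 4 * z0 $ 1 + 2 * c 5 * z0 $ 2"
    have dq: "dq c y = \<alpha> * y $ 1 + \<beta> * y $ 2" for y
      by (simp add: dq_def \<alpha>_def \<beta>_def)
    \<comment> \<open>A linear functional on C^2 has a nonzero kernel vector; the zero functional
      needs its own choice.\<close>
    define y :: "complex ^ 2" where "y = (if \<alpha> = 0 \<and> \<beta> = 0 then axis 1 1 else \<chi> i. if i = 1 then \<beta> else - \<alpha>)"
    have "y \<noteq> 0" "dq c y = 0"
      by (auto simp: y_def dq vec_eq_iff forall_2 axis_def)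
    then show ?thesis
      using that by blast
  qed
  \<comment> \<open>On the sphere the first factor is zero. Inside, a short step along
    \<open>x\<close> stays in the closed ball, and the homogeneity of \<open>A\<close> about
    \<open>z0\<close> removes its length.\<close>
  have "0 \<le> (1 - (norm z0)\<^sup>2) * Re (A (z0 + x) (z0 + x))"
  proof (cases "norm z0 = 1")
    case False
    with z0 have lt: "norm z0 < 1"
      by simp
    define s where "s = (1 - norm z0) / norm x"
    have s: "s > 0"
      using lt x by (simp add: s_def)
    have "norm (z0 + complex_of_real s *s x) \<le> norm z0 + s * norm x"
      using norm_triangle_ineq[of z0 "complex_of_real s *s x"] s by (simp add: norm_vector_scale)
    also have "\<dots> = 1"
      using x by (simp add: s_def)
    finally have "0 \<le> Re (A (z0 + complex_of_real s *s x) (z0 + complex_of_real s *s x))"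
      by (rule nonneg)
    then have "0 \<le> s * (s * Re (A (z0 + x) (z0 + x)))"
      unfolding A A' by simp
    then have "0 \<le> Re (A (z0 + x) (z0 + x))"
      using s by (simp add: zero_le_mult_iff)
    then show ?thesis
      using lt by (simp add: power_le_one_iff)
  qed simp
  also have "\<dots> = - (norm (dp x))\<^sup>2"
    using arg_cong[OF second[of x x], of Re] x by (simp add: cin_self)
  finally have dpx: "dp x = 0"
    by simp
  have "(1 - cin w z0) * A w (z0 + x) = 0" for w
    using arg_cong[OF first[of x w], of cnj] x dpx by (simp add: cnj_cin hermitian)
  then have "A w (z0 + x) = 0" for w
    using affine_mult_eq_0[of "\<lambda>w. A w (z0 + x)"] affine by blast
  then have Ax: "A (z0 + s *s x) w = 0" for s w
    unfolding A using hermitian by (metis complex_cnj_zero mult_zero_right)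
  obtain w where w: "norm (p w) < norm (quad c w)"
    using interior by blast
  \<comment> \<open>On the line \<open>A\<close> vanishes, so |q| = |p| there. Cauchy-Schwarz
    against a point \<open>w\<close> with |p(w)| < |q(w)| then forces both to be zero.\<close>
  have "quad c z = 0 \<and> p z = 0" if "z = z0 + s *s x" for z s
  proof -
    have "quad c z * cnj (quad c w) = cin (p z) (p w)"
      using factor[of z w] Ax by (simp add: that)
    then have "norm (quad c z) * norm (quad c w) \<le> norm (p z) * norm (p w)"
      using norm_cin_le[of "p z" "p w"] by (metis complex_mod_cnj norm_mult)
    moreover have eq: "norm (quad c z) = norm (p z)"
      using factor_diag[of z] Ax by (simp add: that power2_eq_iff_nonneg)
    ultimately have "norm (p z) * (norm (quad c w) - norm (p w)) \<le> 0"
      by (simp add: algebra_simps)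
    then have "norm (p z) \<le> 0"
      using w by (simp add: mult_le_0_iff)
    then show ?thesis
      using eq by simp
  qed
  with x(1) show ?thesis
    by blast
qed

lemma common_factor:
  assumes "norm z0 \<le> 1" "A z0 z0 = 0" "quad c z0 = 0"
  shows "\<exists>l. l dvd quad_poly c \<and> (\<forall>i. l dvd quad_poly (d i)) \<and> total_degree l \<noteq> 0"
proof -
  obtain x where x: "x \<noteq> 0" "\<And>s. quad c (z0 + s *s x) = 0" "\<And>s. p (z0 + s *s x) = 0"
    using null_line[OF assms] by blast
  then have "\<And>s i. quad (d i) (z0 + s *s x) = 0"
    by (simp add: p_def vec_eq_iff)
  with x show ?thesis
    by (intro exI[of _ "line_poly z0 x"]) (simp add: line_poly_dvd total_degree_line_poly)
qed

text \<open>The quotient \<open>g\<close> is positive at 0 and zero on the sphere, so its maximum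
  over the closed ball is attained at an interior \<open>w\<close>. The Hermitian form
  \<open>D\<close> with factor \<open>g w\<close> is nonpositive on the ball and zero at
  \<open>w\<close>, which makes its first-order term at \<open>w\<close> vanish.\<close>

lemma pencil_eigenvector:
  assumes pos: "\<And>z. norm z \<le> 1 \<Longrightarrow> 0 < Re (A z z)" and cont: "continuous_on UNIV (\<lambda>z. A z z)"
  obtains w \<kappa> where "norm w < 1" "\<kappa> > 0" "\<And>z. 1 - cin z w = complex_of_real \<kappa> * A z w"
proof -
  define g where "g z = (1 - (norm z)\<^sup>2) / Re (A z z)" for z
  have "continuous_on (cball 0 1) g"
    unfolding g_def
    by (intro continuous_intros continuous_on_subset[OF cont]) (use pos in force)+
  then obtain w where w: "norm w \<le> 1" and max: "\<And>z. norm z \<le> 1 \<Longrightarrow> g z \<le> g w"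
    using continuous_attains_sup[of "cball (0 :: complex ^ 2) 1" g] by auto
  have "0 < g 0"
    using pos[of 0] by (simp add: g_def)
  also have "\<dots> \<le> g w"
    by (rule max) simp
  finally have gw: "g w > 0" .
  then have lt: "norm w < 1"
    using w by (cases "norm w = 1") (auto simp: g_def)
  define D where "D z z' = (1 - cin z z') - complex_of_real (g w) * A z z'" for z z'
  have D_affine: "D (z + s *s x) v = D z v + s * (D (z + x) v - D z v)" for z s x v
    unfolding D_def affine[of z s x v] by (simp add: cin_simps algebra_simps)
  have D_herm: "cnj (D z z') = D z' z" for z z'
    by (simp add: D_def cnj_cin hermitian)
  have D_neg: "Re (D z z) \<le> 0" if "norm z \<le> 1" for z
  proof -
    have "(1 - (norm z)\<^sup>2) \<le> g w * Re (A z z)"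
      using max[OF that] pos[OF that] by (simp add: g_def pos_divide_le_eq)
    then show ?thesis
      by (simp add: D_def cin_self)
  qed
  have Dww: "D w w = 0"
  proof -
    have "A w w = complex_of_real (Re (A w w))"
      using hermitian[of w w] by (metis Reals_cnj_iff of_real_Re)
    moreover have "1 - (norm w)\<^sup>2 = g w * Re (A w w)"
      using pos[OF w] by (simp add: g_def)
    ultimately show ?thesis
      unfolding D_def cin_self by (metis diff_self of_real_1 of_real_diff of_real_mult)
  qed
  have "D (w + x) w = 0" for x
  proof (rule ccontr)
    define a b where "a = D (w + x) w" and "b = D (w + x) (w + x)"
    assume "D (w + x) w \<noteq> 0"
    then have a: "a \<noteq> 0"
      by (simp add: a_def)
    \<comment> \<open>The real part of the second-order coefficient in \<open>expand\<close>, not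
      the multiplier of the conclusion.\<close>
    define \<kappa> where "\<kappa> = Re b - 2 * Re a"
    have expand: "D (w + s *s x) (w + s *s x) = s * a + cnj (s * a) + s * cnj s * (cnj b - a - cnj a)" for s
    proof -
      have 1: "D w (w + s *s x) = cnj s * cnj a"
        using arg_cong[OF D_affine[of w s x w], of cnj] by (simp add: D_herm Dww a_def)
      have 2: "D w (w + x) = cnj a"
        by (simp add: a_def D_herm)
      have 3: "D (w + x) (w + s *s x) = a + cnj s * (cnj b - a)"
        using arg_cong[OF D_affine[of w s x "w + x"], of cnj] by (simp add: D_herm 2 b_def)
      show ?thesis
        using D_affine[of w s x "w + s *s x"] by (simp add: 1 3 algebra_simps)
    qed
    have x: "norm x > 0"
      using a Dww by (auto simp: a_def)
    \<comment> \<open>The first bound keeps \<open>w + s *s x\<close> in the closed ball; the second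
      keeps the second-order term below the first-order one. Taking \<open>s\<close> along
      \<open>cnj a\<close> makes \<open>s * a\<close> positive.\<close>
    define t where "t = min ((1 - norm w) / (norm a * norm x)) (1 / (\<bar>\<kappa>\<bar> + 1))"
    have t: "t > 0" "t \<le> (1 - norm w) / (norm a * norm x)" "t \<le> 1 / (\<bar>\<kappa>\<bar> + 1)"
      using lt a x by (auto simp: t_def)
    define s where "s = complex_of_real t * cnj a"
    have "norm (w + s *s x) \<le> norm w + norm s * norm x"
      using norm_triangle_ineq[of w "s *s x"] by (simp add: norm_vector_scale)
    also have "\<dots> \<le> 1"
      using t(1,2) a x by (simp add: s_def norm_mult field_simps)
    finally have "Re (D (w + s *s x) (w + s *s x)) \<le> 0"
      by (rule D_neg)
    moreover have "s * a = complex_of_real (t * (norm a)\<^sup>2)" "s * cnj s = complex_of_real (t\<^sup>2 * (norm a)\<^sup>2)"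
      unfolding s_def of_real_mult complex_norm_square by (simp_all add: power2_eq_square)
    ultimately have "2 * (t * (norm a)\<^sup>2) + t\<^sup>2 * (norm a)\<^sup>2 * \<kappa> \<le> 0"
      unfolding expand by (simp add: \<kappa>_def)
    then have "t * (norm a)\<^sup>2 * (2 + t * \<kappa>) \<le> 0"
      by (simp add: algebra_simps power2_eq_square)
    then have "2 + t * \<kappa> \<le> 0"
      using t(1) a by (simp add: mult_le_0_iff)
    moreover have "t * \<bar>\<kappa>\<bar> \<le> 1"
    proof -
      have "t * (\<bar>\<kappa>\<bar> + 1) \<le> 1"
        using t(3) by (simp add: pos_le_divide_eq)
      then show ?thesis
        using t(1) by (simp add: algebra_simps)
    qed
    moreover have "- (t * \<bar>\<kappa>\<bar>) \<le> t * \<kappa>"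
      using t(1) by (simp add: abs_real_def)
    ultimately show False
      by linarith
  qed
  then have "D z w = 0" for z
    by (metis add.commute diff_add_cancel)
  then show ?thesis
    using that[OF lt gw] by (simp add: D_def)
qed

end

section \<open>The polynomial representative\<close>

definition quadratic_fun :: "(complex ^ 2 \<Rightarrow> complex) \<Rightarrow> bool" where
  "quadratic_fun f \<longleftrightarrow> (\<exists>c. f = quad c)"

definition affine_fun :: "(complex ^ 2 \<Rightarrow> complex) \<Rightarrow> bool" where
  "affine_fun f \<longleftrightarrow> (\<exists>a b1 b2. \<forall>z. f z = a + b1 * z $ 1 + b2 * z $ 2)"

lemma quadratic_fun_add:
  assumes "quadratic_fun f" "quadratic_fun g"
  shows "quadratic_fun (\<lambda>z. f z + g z)"
proof -
  obtain c e where ce: "f = quad c" "g = quad e"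
    using assms unfolding quadratic_fun_def by blast
  have "(\<lambda>z. f z + g z) = quad (\<lambda>k. c k + e k)"
    by (simp add: ce quad_def algebra_simps fun_eq_iff)
  then show ?thesis
    unfolding quadratic_fun_def by blast
qed

lemma quadratic_fun_scale:
  assumes "quadratic_fun f"
  shows "quadratic_fun (\<lambda>z. k * f z)"
proof -
  obtain c where c: "f = quad c"
    using assms unfolding quadratic_fun_def by blast
  have "(\<lambda>z. k * f z) = quad (\<lambda>j. k * c j)"
    by (simp add: c quad_def algebra_simps fun_eq_iff)
  then show ?thesis
    unfolding quadratic_fun_def by blast
qed

lemma quadratic_fun_sum: "(\<And>i. i \<in> I \<Longrightarrow> quadratic_fun (f i)) \<Longrightarrow> quadratic_fun (\<lambda>z. \<Sum>i\<in>I. f i z)"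
proof (induction I rule: infinite_finite_induct)
  case (insert i I)
  then show ?case
    by (simp add: quadratic_fun_add)
qed (auto simp: quadratic_fun_def quad_def fun_eq_iff intro!: exI[of _ "\<lambda>_. 0"])

lemma affine_fun_mult:
  assumes "affine_fun f" "affine_fun g"
  shows "quadratic_fun (\<lambda>z. f z * g z)"
proof -
  obtain a b1 b2 where f: "\<And>z. f z = a + b1 * z $ 1 + b2 * z $ 2"
    using assms(1) unfolding affine_fun_def by blast
  obtain a' b1' b2' where g: "\<And>z. g z = a' + b1' * z $ 1 + b2' * z $ 2"
    using assms(2) unfolding affine_fun_def by blast
  define c where "c k = [a * a', a * b1' + b1 * a', a * b2' + b2 * a', b1 * b1', b1 * b2' + b2 * b1', b2 * b2'] ! k" for k
  have "(\<lambda>z. f z * g z) = quad c"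
    by (simp add: f g c_def quad_def fun_eq_iff eval_nat_numeral algebra_simps)
  then show ?thesis
    unfolding quadratic_fun_def by blast
qed

lemma affine_fun_cin: "affine_fun (\<lambda>z. \<alpha> + \<beta> * z $ i + \<gamma> * cin z w)"
proof -
  have "\<alpha> + \<beta> * z $ i + \<gamma> * cin z w = \<alpha> + ((if i = 1 then \<beta> else 0) + \<gamma> * cnj (w $ 1)) * z $ 1
      + ((if i = 2 then \<beta> else 0) + \<gamma> * cnj (w $ 2)) * z $ 2" for z
    using exhaust_2[of i] by (auto simp: cin_def UNIV_2 algebra_simps)
  then show ?thesis
    unfolding affine_fun_def by blast
qed

lemma quadratic_fun_imp_polynomial:
  assumes "\<And>i. \<exists>f. quadratic_fun f \<and> (\<forall>z\<in>ball 0 1. G z $ i = f z)"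
  shows "polynomial_ball_map G"
proof -
  have "\<exists>c. \<forall>z\<in>ball 0 1. G z $ i = quad c z" for i
    using assms[of i] unfolding quadratic_fun_def by blast
  then obtain c where "\<And>i z. z \<in> ball 0 1 \<Longrightarrow> G z $ i = quad (c i) z"
    by metis
  then show ?thesis
    unfolding polynomial_ball_map_def
    by (intro exI[of _ "\<lambda>i. quad_poly (c i)"]) (simp add: eval_quad_poly)
qed

text \<open>The components of the involution are affine functions over the common denominator
  \<open>1 - cin z w\<close>, so a polynomial of degree two in them needs only the square of that
  denominator.\<close>

lemma quad_ball_involution:
  assumes w: "norm w < 1"
  shows "\<exists>f. quadratic_fun f \<and>
    (\<forall>z. norm z < 1 \<longrightarrow> quad c (ball_involution w z) = f z / (1 - cin z w)\<^sup>2)"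
proof -
  define s where "s = complex_of_real (sqrt (1 - (norm w)\<^sup>2))"
  \<comment> \<open>The zero term brings \<open>h\<close> into the shape of
    \<open>affine_fun_cin\<close>.\<close>
  define h where "h z = 1 + 0 * z $ 1 + (-1) * cin z w" for z
  define n where "n i z = w $ i + (- s) * z $ i + (- w $ i / (1 + s)) * cin z w" for i z
  have aff: "affine_fun h" "affine_fun (n i)" for i
    unfolding h_def n_def by (rule affine_fun_cin)+
  define f where "f z = c 0 * (h z * h z) + (c 1 * (h z * n 1 z) + (c 2 * (h z * n 2 z) +
    (c 3 * (n 1 z * n 1 z) + (c 4 * (n 1 z * n 2 z) + c 5 * (n 2 z * n 2 z)))))" for z
  have "quadratic_fun f"
    unfolding f_def by (intro quadratic_fun_add quadratic_fun_scale affine_fun_mult aff)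
  moreover have "quad c (ball_involution w z) = f z / (1 - cin z w)\<^sup>2" if "norm z < 1" for z
  proof -
    have h: "h z = 1 - cin z w" "h z \<noteq> 0"
      using one_minus_cin_neq_0[OF that, of w] w by (simp_all add: h_def)
    have b: "ball_involution w z $ i = n i z / h z" for i
      unfolding ball_involution_def Let_def s_def[symmetric] h(1)[symmetric]
      by (simp add: n_def divide_inverse algebra_simps)
    show ?thesis
      unfolding h(1)[symmetric] quad_def f_def b
      using h(2) by (simp add: field_simps power2_eq_square)
  qed
  ultimately show ?thesis
    by blast
qed

theorem theorem3p1:
  fixes F :: "complex ^ 2 \<Rightarrow> complex ^ 'N::finite"
  assumes "proper_holomorphic_ball_map F"
    and "rational_ball_map_of_degree F 2"
  shows "\<exists>G :: complex ^ 2 \<Rightarrow> complex ^ 'N.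
           proper_holomorphic_ball_map G \<and> polynomial_ball_map G \<and> ball_maps_equivalent F G"
proof -

  \<comment> \<open>The map as a quotient of quadratic polynomials\<close>
  have hol: "holomorphic_map F (ball 0 1)"
    and Fb: "\<And>z. norm z < 1 \<Longrightarrow> norm (F z) < 1"
    and proper: "\<And>K. compact K \<Longrightarrow> K \<subseteq> ball 0 1 \<Longrightarrow> compact {z \<in> ball 0 1. F z \<in> K}"
    using assms(1) unfolding proper_holomorphic_ball_map_def proper_map_ball_iff
    by (auto simp: image_subset_iff)
  obtain P q where red: "reduced_fraction F P q"
    and deg: "2 = Max (insert (total_degree q) (range (\<lambda>j. total_degree (P j))))"
    using assms(2) unfolding rational_ball_map_of_degree_def by blast
  have "total_degree q \<le> 2" "total_degree (P j) \<le> 2" for j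
    unfolding deg by (rule Max_ge; simp)+
  then have "\<exists>c. q = quad_poly c" "\<forall>j. \<exists>c. P j = quad_poly c"
    by (meson cpoly_degree_le_2)+
  then obtain c d where c: "q = quad_poly c" and d: "\<And>j. P j = quad_poly (d j)"
    by metis
  define p where "p z = (\<chi> i. quad (d i) z)" for z
  have F: "F z = inverse (quad c z) *s p z" if "norm z < 1" "quad c z \<noteq> 0" for z
    using red that unfolding reduced_fraction_def
    by (simp add: c d eval_quad_poly p_def vec_eq_iff divide_inverse mult.commute)
  have sum: "(\<Sum>i\<in>UNIV. quad (d i) z * cnj (quad (d i) w)) = cin (p z) (p w)" for z w
    by (simp add: p_def cin_def)
  have "quad_poly c \<noteq> 0"
    using red by (simp add: reduced_fraction_def c)
  then obtain w0 where w0: "norm w0 < 1" "quad c w0 \<noteq> 0"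
    by (rule quad_poly_nonzero_point)
  have pF: "norm (p z) = norm (quad c z) * norm (F z)" if "norm z < 1" "quad c z \<noteq> 0" for z
    using F[OF that] that by (simp add: norm_vector_scale norm_inverse)

  \<comment> \<open>Boundary behaviour of numerator and denominator\<close>
  have cont_q: "continuous_on UNIV (\<lambda>z. norm (quad c z))" and cont_p: "continuous_on UNIV (\<lambda>z. norm (p z))"
    unfolding p_def quad_def by (intro continuous_intros)+
  define seg where "seg z t = z + complex_of_real t *s (w0 - z)" for z t
  have seg: "((\<lambda>t. f (seg z t)) \<longlongrightarrow> f z) (at_right 0)" if "continuous_on UNIV f" for f :: "complex ^ 2 \<Rightarrow> real" and z
    using that tendsto_segment[of z w0] unfolding seg_def
    by (metis continuous_on_eq_continuous_at isCont_tendsto_compose open_UNIV UNIV_I)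
  \<comment> \<open>Inequalities known where the quotient represents \<open>F\<close> pass to the
    closed ball along segments towards \<open>w0\<close>.\<close>
  have closed_ball: "f z \<le> g z" if z: "norm z \<le> 1" and fg: "continuous_on UNIV f" "continuous_on UNIV g"
    and le: "\<forall>\<^sub>F t in at_right 0. norm (seg z t) < 1 \<longrightarrow> quad c (seg z t) \<noteq> 0 \<longrightarrow> f (seg z t) \<le> g (seg z t)"
    for f g :: "complex ^ 2 \<Rightarrow> real" and z
  proof (rule tendsto_le[OF _ seg[OF fg(2)] seg[OF fg(1)]])
    show "\<forall>\<^sub>F t in at_right 0. f (seg z t) \<le> g (seg z t)"
      using le eventually_segment_nonzero[OF w0 z] unfolding seg_def
      by eventually_elim blast
  qed simp
  have ple: "norm (p z) \<le> norm (quad c z)" if "norm z \<le> 1" for z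
  proof (rule closed_ball[OF that cont_p cont_q], intro always_eventually allI impI)
    fix t assume "norm (seg z t) < 1" "quad c (seg z t) \<noteq> 0"
    then show "norm (p (seg z t)) \<le> norm (quad c (seg z t))"
      using pF[of "seg z t"] Fb[of "seg z t"] by (simp add: mult_left_le)
  qed
  \<comment> \<open>By properness the preimage of the closed ball of radius \<open>r\<close> is
    compact, hence stays away from the boundary point \<open>z\<close>; near \<open>z\<close> this
    gives |F| > r. Letting \<open>r\<close> tend to 1 yields equality of norms on the
    sphere.\<close>
  have qle: "r * norm (quad c z) \<le> norm (p z)" if z: "norm z = 1" and r: "0 < r" "r < 1" for z r
  proof (rule closed_ball[OF _ _ cont_p])
    show "continuous_on UNIV (\<lambda>z. r * norm (quad c z))"
      by (intro continuous_on_mult continuous_on_const cont_q)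
    have "compact {z \<in> ball 0 1. F z \<in> cball 0 r}"
      using r by (intro proper) auto
    then have "open (- {z \<in> ball 0 1. F z \<in> cball 0 r})"
      by (intro open_Compl compact_imp_closed)
    moreover have "z \<in> - {z \<in> ball 0 1. F z \<in> cball 0 r}"
      using z by simp
    ultimately have "\<forall>\<^sub>F t in at_right 0. seg z t \<in> - {z \<in> ball 0 1. F z \<in> cball 0 r}"
      unfolding seg_def by (rule topological_tendstoD[OF tendsto_segment])
    then show "\<forall>\<^sub>F t in at_right 0. norm (seg z t) < 1 \<longrightarrow> quad c (seg z t) \<noteq> 0 \<longrightarrow>
        r * norm (quad c (seg z t)) \<le> norm (p (seg z t))"
    proof eventually_elim
      case (elim t)
      then show ?case
        using pF[of "seg z t"] by (auto simp: mult.commute intro!: mult_left_mono)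
    qed
  qed (use z in simp)
  have sphere: "quad c z * cnj (quad c z) - (\<Sum>i\<in>UNIV. quad (d i) z * cnj (quad (d i) z)) = 0" if z: "norm z = 1" for z
  proof -
    have "norm (quad c z) \<le> norm (p z)"
    proof (rule tendsto_upperbound)
      show "((\<lambda>r. r * norm (quad c z)) \<longlongrightarrow> norm (quad c z)) (at_left 1)"
        by (auto intro!: tendsto_eq_intros)
      show "\<forall>\<^sub>F r in at_left 1. r * norm (quad c z) \<le> norm (p z)"
        using qle[OF z] unfolding eventually_at_left_field by (intro exI[of _ 0]) auto
    qed simp
    then have "norm (quad c z) = norm (p z)"
      using ple[of z] z by simp
    then show ?thesis
      unfolding sum unfolding cin_self complex_norm_square[symmetric] by simp
  qed
  have "\<forall>z. norm z = 1 \<longrightarrow>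
      quad c z * cnj (quad c z) - (\<Sum>i\<in>UNIV. quad (d i) z * cnj (quad (d i) z)) = 0"
    using sphere by blast

  \<comment> \<open>The cofactor and its positivity\<close>
  from sphere_factorization[OF this] obtain A where A:
    "\<forall>z w. quad c z * cnj (quad c w) - cin (p z) (p w) = (1 - cin z w) * A z w"
    "\<forall>z w s x. A (z + s *s x) w = A z w + s * (A (z + x) w - A z w)"
    "\<forall>z w. cnj (A z w) = A w z" and cont: "continuous_on UNIV (\<lambda>z. A z z)"
    unfolding sum by (elim exE conjE)
  note factor = A(1)[rule_format] and affine = A(2)[rule_format] and herm = A(3)[rule_format]
  have factor_diag: "(norm (quad c z))\<^sup>2 - (norm (p z))\<^sup>2 = (1 - (norm z)\<^sup>2) * Re (A z z)" for z
    using arg_cong[OF factor[of z z], of Re]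
    unfolding cin_self complex_norm_square[symmetric] by simp
  obtain k where k: "k > 0" "\<And>z. norm z < 1 \<Longrightarrow> k * (1 - (norm z)\<^sup>2) \<le> 1 - (norm (F z))\<^sup>2"
    using ball_map_boundary_distance[OF hol Fb] by blast
  \<comment> \<open>Multiply the boundary estimate for \<open>F\<close> by |q|^2 and cancel
    \<open>1 - |z|^2\<close>. Consequently a zero of \<open>A z z\<close> in the closed ball is a
    zero of \<open>q\<close>.\<close>
  have lower: "k * (norm (quad c z))\<^sup>2 \<le> Re (A z z)" if "norm z \<le> 1" for z
  proof (rule closed_ball[OF that], use cont_q cont in \<open>auto intro!: continuous_intros\<close>)
    show "\<forall>\<^sub>F t in at_right 0. norm (seg z t) < 1 \<longrightarrow> quad c (seg z t) \<noteq> 0 \<longrightarrow>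
      k * (norm (quad c (seg z t)))\<^sup>2 \<le> Re (A (seg z t) (seg z t))"
    proof (intro always_eventually allI impI)
      fix t
      let ?y = "seg z t"
      assume y: "norm ?y < 1" "quad c ?y \<noteq> 0"
      have "(1 - (norm ?y)\<^sup>2) * (k * (norm (quad c ?y))\<^sup>2) \<le> (1 - (norm (F ?y))\<^sup>2) * (norm (quad c ?y))\<^sup>2"
        using mult_right_mono[OF k(2)[OF y(1)], of "(norm (quad c ?y))\<^sup>2"] by (simp add: mult_ac)
      also have "\<dots> = (1 - (norm ?y)\<^sup>2) * Re (A ?y ?y)"
        unfolding factor_diag[symmetric] pF[OF y] by (simp add: algebra_simps power_mult_distrib)
      finally show "k * (norm (quad c ?y))\<^sup>2 \<le> Re (A ?y ?y)"
        using y by (simp add: power_less_one_iff)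
    qed
  qed
  interpret quadratic_ball_quotient c d A p
  proof
    show "0 \<le> Re (A z z)" if "norm z \<le> 1" for z
      using lower[OF that] k(1) by (meson mult_nonneg_nonneg less_imp_le order_trans zero_le_power2)
    have "norm (p w0) < norm (quad c w0)"
      using pF[OF w0] Fb[OF w0(1)] w0(2) by simp
    with w0 show "\<exists>w. norm w < 1 \<and> norm (p w) < norm (quad c w)"
      by blast
  qed (fact p_def factor affine herm)+
  have pos: "0 < Re (A z z)" if z: "norm z \<le> 1" for z
  proof (rule ccontr)
    assume "\<not> 0 < Re (A z z)"
    then have 0: "Re (A z z) = 0"
      using nonneg[OF z] by simp
    then have "A z z = 0"
      using herm[of z z] by (metis Reals_cnj_iff complex_is_Real_iff complex_eq_iff zero_complex.sel)
    moreover have "quad c z = 0"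
      using lower[OF z] k(1) by (simp add: 0 mult_le_0_iff)
    ultimately have "\<exists>l. l dvd quad_poly c \<and> (\<forall>i. l dvd quad_poly (d i)) \<and> total_degree l \<noteq> 0"
      by (rule common_factor[OF z])
    then obtain l where l: "l dvd quad_poly c" "\<forall>i. l dvd quad_poly (d i)" "total_degree l \<noteq> 0"
      by (elim exE conjE)
    have "\<forall>l. l dvd quad_poly c \<and> (\<forall>i. l dvd quad_poly (d i)) \<longrightarrow> total_degree l = 0"
      using red unfolding reduced_fraction_def c d by (elim conjE)
    from this[THEN spec[of _ l], THEN mp, OF conjI, OF l(1,2)] l(3) show False
      by (rule notE[rotated])
  qed

  \<comment> \<open>The conjugated map and its denominator\<close>
  obtain w \<kappa> where w: "norm w < 1" and \<kappa>: "\<kappa> > 0" "\<And>z. 1 - cin z w = complex_of_real \<kappa> * A z w"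
    using pencil_eigenvector[OF pos cont] by blast
  have q_nz: "quad c z \<noteq> 0" if "norm z < 1" for z
  proof
    assume "quad c z = 0"
    then have "(1 - (norm z)\<^sup>2) * Re (A z z) \<le> 0"
      unfolding factor_diag[symmetric] by simp
    moreover have "(1 - (norm z)\<^sup>2) * Re (A z z) > 0"
      using that pos[of z] by (simp add: power_less_one_iff)
    ultimately show False
      by simp
  qed
  define b where "b = F w"
  have b: "norm b < 1"
    unfolding b_def by (rule Fb[OF w])
  define \<mu> where "\<mu> = inverse (complex_of_real \<kappa> * cnj (quad c w))"
  have \<mu>: "\<mu> \<noteq> 0"
    using \<kappa>(1) q_nz[OF w] by (simp add: \<mu>_def)
  \<comment> \<open>Since \<open>p w\<close> is \<open>quad c w\<close> times \<open>b\<close>,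
    multiplication by \<open>cnj (quad c w)\<close> produces the factorised form, in which the
    eigenvector relation replaces \<open>A z w\<close> by
    \<open>(1 - cin z w) / \<kappa>\<close>.\<close>
  have denom: "quad c z - cin (p z) b = \<mu> * (1 - cin z w)\<^sup>2" for z
  proof -
    have "(quad c z - cin (p z) b) * cnj (quad c w) = quad c z * cnj (quad c w) - cin (p z) (p w)"
      using q_nz[OF w] by (simp add: b_def F[OF w q_nz[OF w]] cin_simps algebra_simps)
    also have "\<dots> = (1 - cin z w)\<^sup>2 / complex_of_real \<kappa>"
      unfolding factor using \<kappa> by (simp add: power2_eq_square)
    finally show ?thesis
      using \<kappa>(1) q_nz[OF w] by (simp add: \<mu>_def field_simps)
  qed
  let ?G = "ball_involution b \<circ> F \<circ> ball_involution w"
  have "polynomial_ball_map ?G"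
  proof (rule quadratic_fun_imp_polynomial)
    fix i
    define s where "s = complex_of_real (sqrt (1 - (norm b)\<^sup>2))"
    have "quadratic_fun (\<lambda>z. b $ i * quad c z + ((- s) * quad (d i) z
        + (- b $ i / (1 + s)) * (\<Sum>j\<in>UNIV. cnj (b $ j) * quad (d j) z)))"
      by (intro quadratic_fun_add quadratic_fun_scale quadratic_fun_sum) (auto simp: quadratic_fun_def)
    then obtain e where "(\<lambda>z. b $ i * quad c z + ((- s) * quad (d i) z
        + (- b $ i / (1 + s)) * (\<Sum>j\<in>UNIV. cnj (b $ j) * quad (d j) z))) = quad e"
      unfolding quadratic_fun_def by (elim exE)
    note e = this[THEN fun_cong]
    \<comment> \<open>The numerator of the involution at \<open>b\<close> applied to
      \<open>p / q\<close>, multiplied by \<open>q\<close>, is again a quadratic polynomial.\<close>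
    have num: "b $ i * quad c z - s * p z $ i - cin (p z) b / (1 + s) * b $ i = quad e z" for z
      unfolding e[symmetric] by (simp add: p_def cin_def mult.commute)
    have comp: "ball_involution b (F z) $ i = quad e z / (\<mu> * (1 - cin z w)\<^sup>2)" if z: "norm z < 1" for z
    proof -
      have "cin (F z) b = cin (p z) b / quad c z"
        by (simp add: F[OF z q_nz[OF z]] cin_simps divide_inverse mult.commute)
      moreover have "F z $ i = p z $ i / quad c z"
        by (simp add: F[OF z q_nz[OF z]] divide_inverse mult.commute)
      moreover have "1 - cin (p z) b / quad c z = (quad c z - cin (p z) b) / quad c z"
        using q_nz[OF z] by (simp add: diff_divide_distrib)
      moreover have "b $ i - s * (p z $ i / quad c z) - cin (p z) b / quad c z / (1 + s) * b $ i
          = (b $ i * quad c z - s * p z $ i - cin (p z) b / (1 + s) * b $ i) / quad c z"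
        using q_nz[OF z] by (simp add: diff_divide_distrib)
      ultimately have "ball_involution b (F z) $ i =
          inverse ((quad c z - cin (p z) b) / quad c z) *
          ((b $ i * quad c z - s * p z $ i - cin (p z) b / (1 + s) * b $ i) / quad c z)"
        by (simp only: ball_involution_def Let_def s_def[symmetric] vector_smult_component vector_minus_component)
      then show ?thesis
        unfolding num denom using q_nz[OF z] by (simp add: divide_inverse)
    qed
    from quad_ball_involution[OF w, of e] obtain f where f: "quadratic_fun f"
        "\<forall>z. norm z < 1 \<longrightarrow> quad e (ball_involution w z) = f z / (1 - cin z w)\<^sup>2"
      by (elim exE conjE)
    \<comment> \<open>At the image of \<open>z\<close> under the involution,
      \<open>1 - cin _ w\<close> equals \<open>(1 - |w|^2) / (1 - cin z w)\<close>. Its square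
      cancels the denominator from \<open>quad_ball_involution\<close>, leaving a constant.\<close>
    have "?G z $ i = inverse (\<mu> * (complex_of_real (1 - (norm w)\<^sup>2))\<^sup>2) * f z" if z: "norm z < 1" for z
    proof -
      have nz: "1 - cin z w \<noteq> 0"
        using one_minus_cin_neq_0[OF z] w by simp
      show ?thesis
        using comp[OF ball_involution_in_ball[OF w z]] nz
        unfolding ball_involution_involutive(1)[OF w nz] f(2)[rule_format, OF z]
        by (simp add: divide_inverse power_mult_distrib power_inverse mult_ac)
    qed
    then show "\<exists>f. quadratic_fun f \<and> (\<forall>z\<in>ball 0 1. ?G z $ i = f z)"
      by (intro exI[of _ "\<lambda>z. inverse (\<mu> * (complex_of_real (1 - (norm w)\<^sup>2))\<^sup>2) * f z"])
        (simp add: quadratic_fun_scale[OF f(1)])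
  qed
  then show ?thesis
    using proper_holomorphic_ball_map_conjugate[OF assms(1) w b] by blast
qed

end
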